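(* Let $\mathcal{C}$ be a class of finite cographs. The following are equivalent: (1) $\mathcal{C}$ is $\mathrm{MSO}_1$-orderable; (2) $\mathcal{C}$ has property $\mathsf{CUT}$; (3) there is $d\in\mathbb{N}$ such that the cotree of every graph in $\mathcal{C}$ has outdegree at most $d$.
   Context: A cograph is a graph built from single vertices (constant $1$) using disjoint union $\oplus$ and complete join $\otimes$ (disjoint union plus all edges between the two parts). Regarding $\oplus,\otimes$ as operations of variable arity with unordered arguments, a cotree is a term over $\oplus,\otimes,1$ in which no node is labelled by the same operation as one of its immediate successors; every cograph is denoted by a unique cotree. $\lfloor G\rfloor$ is the structure with universe the vertex set and the edge relation. A graph class is $\mathrm{MSO}_1$-orderable if there is an MSO-formula $\varphi(x,y;Z_0,\dots,Z_{n-1})$ such that for every nonempty $G\in\mathcal{C}$ there are vertex sets $P_i$ with $\{(a,b):\lfloor G\rfloor\models\varphi(a,b;\bar P)\}$ a linear order on the vertices. A graph with ports in $[k]$ is a graph with $\pi:V\to[k]$; for $R\subseteq[k]\times[k]$, $G\otimes_R H$ is the disjoint union plus all edges $\{x,y\}$ with $x,y$ in different operands, labels $a,b$ with $(a,b)\in R$ (associative, commutative); $\mathrm{Del}$ deletes labels; $\mathrm{Cut}(G,k)$ is the maximal $n$ with $G\cong\mathrm{Del}(H_0\otimes_R\cdots\otimes_R H_{n-1})$ for nonempty $H_i$ with ports in $[k]$ and some $R$. $\mathcal{C}$ has $\mathsf{CUT}$ if there is $f$ with $\mathrm{Cut}(G,k)\le f(k)$ for all $G\in\mathcal{C}$, $k$.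 *)

theory Defs
  imports Main
begin

text \<open>A graph is a pair (vertex set, edge relation); edges are stored as ordered pairs
  in both directions (symmetric, irreflexive relation on the vertex set).\<close>

type_synonym 'v graph = "'v set \<times> ('v \<times> 'v) set"

definition verts :: "'v graph \<Rightarrow> 'v set" where "verts G = fst G"
definition edges :: "'v graph \<Rightarrow> ('v \<times> 'v) set" where "edges G = snd G"

definition finite_graph :: "'v graph \<Rightarrow> bool" where
  "finite_graph G \<longleftrightarrow> finite (verts G) \<and> edges G \<subseteq> verts G \<times> verts G
     \<and> sym (edges G) \<and> irrefl (edges G)"

definition graph_iso :: "'v graph \<Rightarrow> 'w graph \<Rightarrow> bool" where
  "graph_iso G H \<longleftrightarrow> (\<exists>h. bij_betw h (verts G) (verts H) \<and>
     (\<forall>u\<in>verts G. \<forall>v\<in>verts G. (u, v) \<in> edges G \<longleftrightarrow> (h u, h v) \<in> edges H))"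

inductive cograph :: "'v graph \<Rightarrow> bool" where
  single: "cograph ({v}, {})"
| union: "\<lbrakk>cograph (V1, E1); cograph (V2, E2); V1 \<inter> V2 = {}\<rbrakk>
           \<Longrightarrow> cograph (V1 \<union> V2, E1 \<union> E2)"
| join: "\<lbrakk>cograph (V1, E1); cograph (V2, E2); V1 \<inter> V2 = {}\<rbrakk>
           \<Longrightarrow> cograph (V1 \<union> V2, E1 \<union> E2 \<union> V1 \<times> V2 \<union> V2 \<times> V1)"

text \<open>Cotree terms: a leaf is a vertex (the constant 1 placed at that vertex);
  an inner node is labelled by an operation (False = disjoint union, True = complete join)
  and has a list of arguments (the order of arguments is irrelevant for everything below).\<close>

datatype 'v cotree = Leaf 'v | Node bool "'v cotree list"

fun leaves :: "'v cotree \<Rightarrow> 'v set" where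
  "leaves (Leaf v) = {v}"
| "leaves (Node b ts) = (\<Union>t\<in>set ts. leaves t)"

fun cotree_edges :: "'v cotree \<Rightarrow> ('v \<times> 'v) set" where
  "cotree_edges (Leaf v) = {}"
| "cotree_edges (Node b ts) = (\<Union>t\<in>set ts. cotree_edges t) \<union>
     (if b then {(u, w). \<exists>i<length ts. \<exists>j<length ts. i \<noteq> j \<and>
                   u \<in> leaves (ts ! i) \<and> w \<in> leaves (ts ! j)} else {})"

definition cotree_graph :: "'v cotree \<Rightarrow> 'v graph" where
  "cotree_graph t = (leaves t, cotree_edges t)"

fun is_op :: "bool \<Rightarrow> 'v cotree \<Rightarrow> bool" where
  "is_op b (Leaf v) = False"
| "is_op b (Node c ts) = (b = c)"

fun wf_cotree :: "'v cotree \<Rightarrow> bool" where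
  "wf_cotree (Leaf v) = True"
| "wf_cotree (Node b ts) \<longleftrightarrow> length ts \<ge> 2 \<and> (\<forall>t\<in>set ts. wf_cotree t \<and> \<not> is_op b t)
     \<and> (\<forall>i<length ts. \<forall>j<length ts. i \<noteq> j \<longrightarrow> leaves (ts ! i) \<inter> leaves (ts ! j) = {})"

fun outdeg :: "'v cotree \<Rightarrow> nat" where
  "outdeg (Leaf v) = 0"
| "outdeg (Node b ts) = max (length ts) (Max (insert 0 (set (map outdeg ts))))"

text \<open>First-order variables and set variables are named by natural numbers
  (two separate name spaces).\<close>
datatype mso =
    Adj nat nat
  | Eqv nat nat
  | Mem nat nat
  | Neg mso
  | Conj mso mso
  | ExF nat mso
  | ExS nat mso

fun sat :: "'v graph \<Rightarrow> (nat \<Rightarrow> 'v) \<Rightarrow> (nat \<Rightarrow> 'v set) \<Rightarrow> mso \<Rightarrow> bool" where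
  "sat G fo so (Adj x y) \<longleftrightarrow> (fo x, fo y) \<in> edges G"
| "sat G fo so (Eqv x y) \<longleftrightarrow> fo x = fo y"
| "sat G fo so (Mem x X) \<longleftrightarrow> fo x \<in> so X"
| "sat G fo so (Neg \<phi>) \<longleftrightarrow> \<not> sat G fo so \<phi>"
| "sat G fo so (Conj \<phi> \<psi>) \<longleftrightarrow> sat G fo so \<phi> \<and> sat G fo so \<psi>"
| "sat G fo so (ExF x \<phi>) \<longleftrightarrow> (\<exists>a\<in>verts G. sat G (fo(x := a)) so \<phi>)"
| "sat G fo so (ExS X \<phi>) \<longleftrightarrow> (\<exists>A\<subseteq>verts G. sat G fo (so(X := A)) \<phi>)"

text \<open>Evaluation of \<phi>(x,y;Z_0,...,Z_{n-1}): x is first-order variable 0, y is variable 1,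
  Z_i is set variable i.  Other (unintended) free variables get fixed default values
  (first-order variables the value of x, set variables the empty set); since these are
  MSO-definable this does not change expressive power.\<close>
definition sat_xyZ :: "'v graph \<Rightarrow> mso \<Rightarrow> nat \<Rightarrow> 'v \<Rightarrow> 'v \<Rightarrow> (nat \<Rightarrow> 'v set) \<Rightarrow> bool" where
  "sat_xyZ G \<phi> n a b P = sat G (\<lambda>i. if i = 1 then b else a) (\<lambda>i. if i < n then P i else {}) \<phi>"

definition mso_orderable :: "'v graph set \<Rightarrow> bool" where
  "mso_orderable C \<longleftrightarrow> (\<exists>\<phi> n. \<forall>G\<in>C. verts G \<noteq> {} \<longrightarrow>
     (\<exists>P. (\<forall>i<n. P i \<subseteq> verts G) \<and>
        linear_order_on (verts G)
          {(a, b). a \<in> verts G \<and> b \<in> verts G \<and> sat_xyZ G \<phi> n a b P}))"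

text \<open>Ports in [k] = {1..k}.  Del(H_0 \<otimes>_R ... \<otimes>_R H_{n-1}): vertex set is the disjoint union
  {(i,v). i<n, v \<in> V(H_i)}; edges are those inside each H_i plus all pairs of vertices in
  different operands whose labels (a,b) satisfy (a,b) \<in> R (edges are unordered, so either
  orientation counts); Del forgets the labels.\<close>
definition del_prod :: "nat \<Rightarrow> (nat \<Rightarrow> nat graph) \<Rightarrow> (nat \<Rightarrow> nat \<Rightarrow> nat) \<Rightarrow> (nat \<times> nat) set
    \<Rightarrow> (nat \<times> nat) graph" where
  "del_prod n H \<pi> R =
     ({(i, v). i < n \<and> v \<in> verts (H i)},
      {((i, u), (j, w)). i < n \<and> j < n \<and> u \<in> verts (H i) \<and> w \<in> verts (H j) \<and>
         ((i = j \<and> (u, w) \<in> edges (H i)) \<or>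
          (i \<noteq> j \<and> ((\<pi> i u, \<pi> j w) \<in> R \<or> (\<pi> j w, \<pi> i u) \<in> R)))})"

definition cut_decomp :: "'v graph \<Rightarrow> nat \<Rightarrow> nat \<Rightarrow> bool" where
  "cut_decomp G k n \<longleftrightarrow> (\<exists>H \<pi> R. R \<subseteq> {1..k} \<times> {1..k} \<and>
     (\<forall>i<n. finite_graph (H i) \<and> verts (H i) \<noteq> {} \<and> \<pi> i ` verts (H i) \<subseteq> {1..k}) \<and>
     graph_iso G (del_prod n H \<pi> R))"

definition Cut :: "'v graph \<Rightarrow> nat \<Rightarrow> nat" where
  "Cut G k = (GREATEST n. cut_decomp G k n)"

definition has_CUT :: "'v graph set \<Rightarrow> bool" where
  "has_CUT C \<longleftrightarrow> (\<exists>f :: nat \<Rightarrow> nat. \<forall>G\<in>C. \<forall>k. Cut G k \<le> f k)"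

definition bounded_cotree_outdeg :: "'v graph set \<Rightarrow> bool" where
  "bounded_cotree_outdeg C \<longleftrightarrow> (\<exists>d::nat. \<forall>G\<in>C. \<forall>t. wf_cotree t \<and> cotree_graph t = G
      \<longrightarrow> outdeg t \<le> d)"

end

theory Submission
  imports Defs
begin

text \<open>The implications are proved in a cycle.

  Orderability bounds \<open>Cut\<close> by a composition argument: the truth of a formula in a product
  depends only on finitely many properties of each operand. With too many operands, two of them
  with one marked vertex each have the same properties, so the formula cannot distinguish the
  pair of marked vertices from the reversed pair.

  A node of the cotree with \<open>d\<close> children splits the graph into \<open>d\<close> parts (the vertices
  outside the node join one of the children), and three ports describe the edges between the
  parts: inside the node, outside and adjacent to it, outside and not adjacent to it.

  If the outdegree is bounded, order the leaves by first ordering the children of every node.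
  The children of a node are told apart by whether the subgraph they induce has a maximal clique
  inside the parameter \<open>Z\<^sub>i\<close>. These answers are the values of the cotree read as an and-or
  tree, and the alternation of the operations leaves enough freedom to choose the parameters so
  that siblings always have different values.\<close>

section \<open>Composition\<close>

text \<open>The ordering formula sees only the graph, so the child containing \<open>x\<close> below
  the lowest common ancestor of \<open>x\<close> and \<open>y\<close> must be definable from these
  two vertices. Maximal cliques are used because a single set quantifier then evaluates a whole
  subtree without reference to its inner nodes. The number of parameters comes from a counting
  balance. With outdegree at most \<open>w\<close>, a set of size between \<open>w\<close> and
  \<open>2 * w\<close> is a union of any number (from 2 to \<open>w\<close>) of distinct sets of
  size at most \<open>w\<close>. Complements in a universe of size \<open>2 * w\<close> turn this
  into the dual statement on intersections of sets of size at least \<open>w\<close>. Hence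
  \<open>2 * w\<close> parameters suffice: what a disjunctive node demands of its children is what a
  conjunctive node can provide, and conversely. Siblings are compared lexicographically by their bit
  vectors. In the composition argument, the finite family of properties depends on the formula and
  the number of ports only, not on the port relation, the graph or the parameters; this uniformity
  makes the bound on the number of operands a function of the number of ports.\<close>

type_synonym 'v piece =
  "'v set \<times> ('v \<times> 'v) set \<times> ('v \<Rightarrow> nat) \<times> (nat \<Rightarrow> 'v option) \<times> (nat \<Rightarrow> 'v set)"

text \<open>One operand together with the part of the valuation that falls into it. A first-order
  variable lives in exactly one operand, hence the option type. Edges and ports are left
  unrestricted, since the properties built below read them only at values of variables located in
  the piece.\<close>

definition piece :: "'v graph \<Rightarrow> ('v \<Rightarrow> nat) \<Rightarrow> ('v \<Rightarrow> nat) \<Rightarrow> (nat \<Rightarrow> 'v) \<Rightarrow> (nat \<Rightarrow> 'v set)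
    \<Rightarrow> nat \<Rightarrow> 'v piece" where
  "piece G c p fo so i =
     ({v \<in> verts G. c v = i}, edges G, p, (\<lambda>x. if c (fo x) = i then Some (fo x) else None),
      (\<lambda>X. so X \<inter> {v \<in> verts G. c v = i}))"

fun upd_fo :: "nat \<Rightarrow> 'v option \<Rightarrow> 'v piece \<Rightarrow> 'v piece" where
  "upd_fo x a (A, E, p, f, s) = (A, E, p, f(x := a), s)"

fun upd_so :: "nat \<Rightarrow> 'v set \<Rightarrow> 'v piece \<Rightarrow> 'v piece" where
  "upd_so X S (A, E, p, f, s) = (A, E, p, f, s(X := S))"

definition agree :: "('a \<Rightarrow> bool) set \<Rightarrow> 'a \<Rightarrow> 'a \<Rightarrow> bool" where
  "agree F P Q \<longleftrightarrow> (\<forall>\<Phi>\<in>F. \<Phi> P \<longleftrightarrow> \<Phi> Q)"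

text \<open>A product of graphs with ports, seen from inside the finished graph: \<open>c\<close>
  names the operand of a vertex and \<open>p\<close> its port.\<close>

definition port_split :: "'v graph \<Rightarrow> nat \<Rightarrow> (nat \<times> nat) set \<Rightarrow> ('v \<Rightarrow> nat) \<Rightarrow> ('v \<Rightarrow> nat) \<Rightarrow> bool"
  where "port_split G k R c p \<longleftrightarrow> p ` verts G \<subseteq> {1..k} \<and>
    (\<forall>u\<in>verts G. \<forall>w\<in>verts G. c u \<noteq> c w \<longrightarrow>
       ((u, w) \<in> edges G \<longleftrightarrow> (p u, p w) \<in> R \<or> (p w, p u) \<in> R))"

text \<open>Feferman-Vaught property, with operands matched index by index. An implication is
  enough, because the two sides can be exchanged. The relation \<open>R\<close> is quantified
  inside, so one family \<open>F\<close> serves all port relations.\<close>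

definition composes :: "nat \<Rightarrow> mso \<Rightarrow> ('v piece \<Rightarrow> bool) set \<Rightarrow> bool" where
  "composes k \<phi> F \<longleftrightarrow> (\<forall>G G' R c c' p p' fo fo' so so'.
     port_split G k R c p \<longrightarrow> port_split G' k R c' p' \<longrightarrow>
     (\<forall>x. fo x \<in> verts G) \<longrightarrow> (\<forall>x. fo' x \<in> verts G') \<longrightarrow>
     (\<forall>i. agree F (piece G c p fo so i) (piece G' c' p' fo' so' i)) \<longrightarrow>
     sat G fo so \<phi> \<longrightarrow> sat G' fo' so' \<phi>)"

lemma composesD:
  assumes "composes k \<phi> F" "port_split G k R c p" "port_split G' k R c' p'"
    "\<And>x. fo x \<in> verts G" "\<And>x. fo' x \<in> verts G'"
    "\<And>i. agree F (piece G c p fo so i) (piece G' c' p' fo' so' i)" "sat G fo so \<phi>"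
  shows "sat G' fo' so' \<phi>"
  using assms unfolding composes_def by blast

lemma agree_sym: "agree F P Q \<Longrightarrow> agree F Q P"
  by (auto simp: agree_def)

lemma agree_Un: "agree (F \<union> F') P Q \<longleftrightarrow> agree F P Q \<and> agree F' P Q"
  by (auto simp: agree_def)

lemma agreeD: "agree F P Q \<Longrightarrow> \<Phi> \<in> F \<Longrightarrow> \<Phi> P \<longleftrightarrow> \<Phi> Q"
  by (auto simp: agree_def)

lemma piece_upd_fo:
  "piece G c p (fo(x := a)) so i = upd_fo x (if c a = i then Some a else None) (piece G c p fo so i)"
  by (auto simp: piece_def)

lemma piece_upd_so:
  "piece G c p fo (so(X := S)) i = upd_so X (S \<inter> {v \<in> verts G. c v = i}) (piece G c p fo so i)"
  by (simp add: piece_def fun_eq_iff)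

lemma fst_piece: "fst (piece G c p fo so i) = {v \<in> verts G. c v = i}"
  by (simp add: piece_def)

definition has_var :: "nat \<Rightarrow> 'v piece \<Rightarrow> bool" where
  "has_var x = (\<lambda>(A, E, p, f, s). f x \<noteq> None)"
definition port_is :: "nat \<Rightarrow> nat \<Rightarrow> 'v piece \<Rightarrow> bool" where
  "port_is x a = (\<lambda>(A, E, p, f, s). f x \<noteq> None \<and> p (the (f x)) = a)"
definition adj_in :: "nat \<Rightarrow> nat \<Rightarrow> 'v piece \<Rightarrow> bool" where
  "adj_in x y = (\<lambda>(A, E, p, f, s). f x \<noteq> None \<and> f y \<noteq> None \<and> (the (f x), the (f y)) \<in> E)"
definition eq_in :: "nat \<Rightarrow> nat \<Rightarrow> 'v piece \<Rightarrow> bool" where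
  "eq_in x y = (\<lambda>(A, E, p, f, s). f x \<noteq> None \<and> f x = f y)"
definition mem_in :: "nat \<Rightarrow> nat \<Rightarrow> 'v piece \<Rightarrow> bool" where
  "mem_in x X = (\<lambda>(A, E, p, f, s). f x \<noteq> None \<and> the (f x) \<in> s X)"

lemma has_var_piece: "has_var x (piece G c p fo so i) \<longleftrightarrow> c (fo x) = i"
  by (auto simp: has_var_def piece_def)
lemma port_is_piece: "port_is x a (piece G c p fo so i) \<longleftrightarrow> c (fo x) = i \<and> p (fo x) = a"
  by (auto simp: port_is_def piece_def)
lemma adj_in_piece: "adj_in x y (piece G c p fo so i) \<longleftrightarrow>
    c (fo x) = i \<and> c (fo y) = i \<and> (fo x, fo y) \<in> edges G"
  by (auto simp: adj_in_def piece_def)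
lemma eq_in_piece: "eq_in x y (piece G c p fo so i) \<longleftrightarrow> c (fo x) = i \<and> fo x = fo y"
  by (auto simp: eq_in_def piece_def)
lemma mem_in_piece: "mem_in x X (piece G c p fo so i) \<longleftrightarrow>
    c (fo x) = i \<and> fo x \<in> so X \<and> fo x \<in> verts G"
  by (auto simp: mem_in_def piece_def)

text \<open>Inside one operand adjacency is a local property; between two operands it is determined
  by the ports and \<open>R\<close>. The bound \<open>k\<close> on the ports keeps the family
  finite.\<close>

lemma composes_Adj:
  "composes k (Adj x y) ({has_var x, has_var y, adj_in x y}
     \<union> port_is x ` {1..k} \<union> port_is y ` {1..k})" (is "composes k _ ?F")
  unfolding composes_def
proof (intro allI impI)
  fix G G' :: "'a graph" and R c c' p p' fo fo' so so'
  assume sp: "port_split G k R c p" and sp': "port_split G' k R c' p'"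
    and fo: "\<forall>x. fo x \<in> verts G" and fo': "\<forall>x. fo' x \<in> verts G'"
    and ag: "\<forall>i. agree ?F (piece G c p fo so i) (piece G' c' p' fo' so' i)"
    and sat: "sat G fo so (Adj x y)"
  have ag': "\<Phi> (piece G c p fo so i) \<longleftrightarrow> \<Phi> (piece G' c' p' fo' so' i)" if "\<Phi> \<in> ?F" for \<Phi> i
    using ag that unfolding agree_def by blast
  have cx: "c' (fo' x) = c (fo x)"
    using ag'[of "has_var x" "c (fo x)"] by (simp add: has_var_piece)
  have cy: "c' (fo' y) = c (fo y)"
    using ag'[of "has_var y" "c (fo y)"] by (simp add: has_var_piece)
  have "p (fo x) \<in> {1..k}" "p (fo y) \<in> {1..k}"
    using sp fo unfolding port_split_def by blast+
  then have px: "p' (fo' x) = p (fo x)" and py: "p' (fo' y) = p (fo y)"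
    using ag'[of "port_is x (p (fo x))" "c (fo x)"] ag'[of "port_is y (p (fo y))" "c (fo y)"]
    by (auto simp: port_is_piece)
  show "sat G' fo' so' (Adj x y)"
  proof (cases "c (fo x) = c (fo y)")
    case True
    then show ?thesis
      using ag'[of "adj_in x y" "c (fo x)"] sat by (simp add: adj_in_piece)
  next
    case False
    then have "(p (fo x), p (fo y)) \<in> R \<or> (p (fo y), p (fo x)) \<in> R"
      using sat sp fo by (auto simp: port_split_def)
    then show ?thesis
      using sp' fo' False cx cy px py by (simp add: port_split_def)
  qed
qed

lemma composes_Eqv: "composes k (Eqv x y) {eq_in x y}"
  unfolding composes_def
proof (intro allI impI)
  fix G G' :: "'a graph" and R c c' p p' fo fo' so so'
  assume ag: "\<forall>i. agree {eq_in x y} (piece G c p fo so i) (piece G' c' p' fo' so' i)"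
    and "sat G fo so (Eqv x y)"
  then show "sat G' fo' so' (Eqv x y)"
    using agreeD[OF spec[OF ag], of "eq_in x y" "c (fo x)"] by (simp add: eq_in_piece)
qed

lemma composes_Mem: "composes k (Mem x X) {mem_in x X}"
  unfolding composes_def
proof (intro allI impI)
  fix G G' :: "'a graph" and R c c' p p' fo fo' so so'
  assume ag: "\<forall>i. agree {mem_in x X} (piece G c p fo so i) (piece G' c' p' fo' so' i)"
    and "\<forall>x. fo x \<in> verts G" "sat G fo so (Mem x X)"
  then show "sat G' fo' so' (Mem x X)"
    using agreeD[OF spec[OF ag], of "mem_in x X" "c (fo x)"] by (simp add: mem_in_piece)
qed

lemma composes_Neg:
  assumes "composes k \<phi> F"
  shows "composes k (Neg \<phi>) F"
  unfolding composes_def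
proof (intro allI impI)
  fix G G' :: "'a graph" and R c c' p p' fo fo' so so'
  assume sp: "port_split G k R c p" "port_split G' k R c' p'"
    and fo: "\<forall>x. fo x \<in> verts G" "\<forall>x. fo' x \<in> verts G'"
    and ag: "\<forall>i. agree F (piece G c p fo so i) (piece G' c' p' fo' so' i)"
    and sat: "sat G fo so (Neg \<phi>)"
  have "sat G fo so \<phi>" if "sat G' fo' so' \<phi>"
    by (rule composesD[OF assms sp(2,1) _ _ _ that]) (use fo ag in \<open>auto intro: agree_sym\<close>)
  then show "sat G' fo' so' (Neg \<phi>)" using sat by auto
qed

lemma composes_Conj:
  assumes "composes k \<phi> F" "composes k \<psi> F'"
  shows "composes k (Conj \<phi> \<psi>) (F \<union> F')"
  unfolding composes_def
proof (intro allI impI)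
  fix G G' :: "'a graph" and R c c' p p' fo fo' so so'
  assume sp: "port_split G k R c p" "port_split G' k R c' p'"
    and fo: "\<forall>x. fo x \<in> verts G" "\<forall>x. fo' x \<in> verts G'"
    and ag: "\<forall>i. agree (F \<union> F') (piece G c p fo so i) (piece G' c' p' fo' so' i)"
    and sat: "sat G fo so (Conj \<phi> \<psi>)"
  have "sat G' fo' so' \<phi>"
    by (rule composesD[OF assms(1) sp]) (use fo ag sat in \<open>auto simp: agree_Un\<close>)
  moreover have "sat G' fo' so' \<psi>"
    by (rule composesD[OF assms(2) sp]) (use fo ag sat in \<open>auto simp: agree_Un\<close>)
  ultimately show "sat G' fo' so' (Conj \<phi> \<psi>)" by simp
qed

text \<open>The witness lies in one piece only. The properties indexed by \<open>T\<close> say which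
  exact types a new vertex of the piece can realise, so a witness of the same type exists in the
  matching piece; the properties with \<open>None\<close> take care of all pieces that do not
  receive the witness.\<close>

lemma composes_ExF:
  assumes "composes k \<phi> F"
  shows "composes k (ExF x \<phi>)
    ((\<lambda>\<Phi> P. \<Phi> (upd_fo x None P)) ` F \<union>
     (\<lambda>T P. \<exists>a\<in>fst P. \<forall>\<Phi>\<in>F. \<Phi> (upd_fo x (Some a) P) \<longleftrightarrow> \<Phi> \<in> T) ` Pow F)"
    (is "composes k _ (?N \<union> ?S ` Pow F)")
  unfolding composes_def
proof (intro allI impI)
  fix G G' :: "'a graph" and R c c' p p' fo fo' so so'
  assume sp: "port_split G k R c p" "port_split G' k R c' p'"
    and fo: "\<forall>x. fo x \<in> verts G" "\<forall>x. fo' x \<in> verts G'"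
    and ag: "\<forall>i. agree (?N \<union> ?S ` Pow F) (piece G c p fo so i) (piece G' c' p' fo' so' i)"
    and sat: "sat G fo so (ExF x \<phi>)"
  from sat obtain a where a: "a \<in> verts G" "sat G (fo(x := a)) so \<phi>" by auto
  let ?P = "piece G c p fo so" and ?P' = "piece G' c' p' fo' so'"
  define T where "T = {\<Phi> \<in> F. \<Phi> (upd_fo x (Some a) (?P (c a)))}"
  have "?S T (?P (c a))"
    using a(1) by (auto simp: T_def fst_piece)
  moreover have "?S T \<in> ?N \<union> ?S ` Pow F"
    by (intro UnI2 imageI) (auto simp: T_def)
  ultimately have "?S T (?P' (c a))"
    using agreeD[OF spec[OF ag], of "?S T" "c a"] by simp
  then obtain a' where a': "a' \<in> verts G'" "c' a' = c a"
    and eq: "\<forall>\<Phi>\<in>F. \<Phi> (upd_fo x (Some a') (?P' (c a))) \<longleftrightarrow> \<Phi> \<in> T"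
    by (auto simp: fst_piece)
  have "agree F (piece G c p (fo(x := a)) so i) (piece G' c' p' (fo'(x := a')) so' i)" for i
  proof (cases "i = c a")
    case True
    then show ?thesis using eq a' by (auto simp: piece_upd_fo agree_def T_def)
  next
    case False
    have "\<Phi> (upd_fo x None (?P i)) \<longleftrightarrow> \<Phi> (upd_fo x None (?P' i))" if "\<Phi> \<in> F" for \<Phi>
      using agreeD[OF spec[OF ag], of "\<lambda>P. \<Phi> (upd_fo x None P)" i] that by blast
    then show ?thesis using False a' by (auto simp: piece_upd_fo agree_def)
  qed
  then have "sat G' (fo'(x := a')) so' \<phi>"
    by (intro composesD[OF assms sp _ _ _ a(2)]) (use fo a a' in auto)
  then show "sat G' fo' so' (ExF x \<phi>)" using a' by auto
qed

text \<open>A set splits into independent traces on the pieces. Each trace is replaced by one of the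
  same type \<open>T i\<close> in the matching piece, and the union of the replacements is the new
  set.\<close>

lemma composes_ExS:
  assumes "composes k \<phi> F"
  shows "composes k (ExS X \<phi>)
    ((\<lambda>T P. \<exists>S\<subseteq>fst P. \<forall>\<Phi>\<in>F. \<Phi> (upd_so X S P) \<longleftrightarrow> \<Phi> \<in> T) ` Pow F)"
    (is "composes k _ (?S ` Pow F)")
  unfolding composes_def
proof (intro allI impI)
  fix G G' :: "'a graph" and R c c' p p' fo fo' so so'
  assume sp: "port_split G k R c p" "port_split G' k R c' p'"
    and fo: "\<forall>x. fo x \<in> verts G" "\<forall>x. fo' x \<in> verts G'"
    and ag: "\<forall>i. agree (?S ` Pow F) (piece G c p fo so i) (piece G' c' p' fo' so' i)"
    and sat: "sat G fo so (ExS X \<phi>)"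
  from sat obtain A where A: "A \<subseteq> verts G" "sat G fo (so(X := A)) \<phi>" by auto
  let ?P = "piece G c p fo so" and ?P' = "piece G' c' p' fo' so'"
  let ?A = "\<lambda>i. A \<inter> {v \<in> verts G. c v = i}"
  define T where "T = (\<lambda>i. {\<Phi> \<in> F. \<Phi> (upd_so X (?A i) (?P i))})"
  have "\<forall>i. \<exists>B. B \<subseteq> {v \<in> verts G'. c' v = i} \<and>
      (\<forall>\<Phi>\<in>F. \<Phi> (upd_so X B (?P' i)) \<longleftrightarrow> \<Phi> \<in> T i)"
  proof
    fix i
    have "?S (T i) (?P i)"
      by (intro exI[of _ "?A i"]) (auto simp: T_def fst_piece)
    moreover have "?S (T i) \<in> ?S ` Pow F"
      by (intro imageI) (auto simp: T_def)
    ultimately have "?S (T i) (?P' i)"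
      using agreeD[OF spec[OF ag], of "?S (T i)" i] by simp
    then show "\<exists>B. B \<subseteq> {v \<in> verts G'. c' v = i} \<and>
        (\<forall>\<Phi>\<in>F. \<Phi> (upd_so X B (?P' i)) \<longleftrightarrow> \<Phi> \<in> T i)"
      by (simp add: fst_piece)
  qed
  from choice[OF this] obtain B where B_eq: "\<forall>i. B i \<subseteq> {v \<in> verts G'. c' v = i} \<and>
      (\<forall>\<Phi>\<in>F. \<Phi> (upd_so X (B i) (?P' i)) \<longleftrightarrow> \<Phi> \<in> T i)" ..
  have B: "B i \<subseteq> {v \<in> verts G'. c' v = i}"
    and eq: "\<forall>\<Phi>\<in>F. \<Phi> (upd_so X (B i) (?P' i)) \<longleftrightarrow> \<Phi> \<in> T i" for i
    using spec[OF B_eq] by simp_all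
  define S where "S = (\<Union>i. B i)"
  have S: "S \<inter> {v \<in> verts G'. c' v = i} = B i" for i
  proof (intro equalityI subsetI)
    fix x assume "x \<in> S \<inter> {v \<in> verts G'. c' v = i}"
    then obtain j where "x \<in> B j" "c' x = i" by (auto simp: S_def)
    moreover then have "c' x = j" using B[of j] by auto
    ultimately show "x \<in> B i" by simp
  next
    fix x assume "x \<in> B i"
    then show "x \<in> S \<inter> {v \<in> verts G'. c' v = i}" using B[of i] by (auto simp: S_def)
  qed
  have "agree F (piece G c p fo (so(X := A)) i) (piece G' c' p' fo' (so'(X := S)) i)" for i
    using eq[of i] by (auto simp: piece_upd_so S agree_def T_def)
  then have "sat G' fo' (so'(X := S)) \<phi>"
    by (intro composesD[OF assms sp _ _ _ A(2)]) (use fo in auto)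
  moreover have "S \<subseteq> verts G'" using B by (auto simp: S_def)
  ultimately show "sat G' fo' so' (ExS X \<phi>)" by auto
qed

text \<open>Each quantifier makes the family grow exponentially, through the powerset of types, but
  keeps it finite.\<close>

lemma composition: "\<exists>F :: ('v piece \<Rightarrow> bool) set. finite F \<and> composes k \<phi> F"
proof (induction \<phi>)
  case (Adj x y)
  show ?case by (rule exI, rule conjI[OF _ composes_Adj]) simp
next
  case (Eqv x y)
  show ?case by (rule exI, rule conjI[OF _ composes_Eqv]) simp
next
  case (Mem x X)
  show ?case by (rule exI, rule conjI[OF _ composes_Mem]) simp
next
  case (Neg \<phi>)
  then show ?case using composes_Neg by blast
next
  case (Conj \<phi> \<psi>)
  then obtain F F' :: "('v piece \<Rightarrow> bool) set"
    where "finite F" "composes k \<phi> F" "finite F'" "composes k \<psi> F'" by auto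
  then show ?case using composes_Conj finite_UnI by blast
next
  case (ExF x \<phi>)
  then obtain F :: "('v piece \<Rightarrow> bool) set" where F: "finite F" "composes k \<phi> F" by auto
  show ?case by (rule exI, rule conjI[OF _ composes_ExF[OF F(2)]]) (simp add: F(1))
next
  case (ExS X \<phi>)
  then obtain F :: "('v piece \<Rightarrow> bool) set" where F: "finite F" "composes k \<phi> F" by auto
  show ?case by (rule exI, rule conjI[OF _ composes_ExS[OF F(2)]]) (simp add: F(1))
qed

section \<open>Products of graphs with ports as labelled partitions of the vertex set\<close>

lemma cut_decomp_imp_port_split:
  assumes "cut_decomp G k n"
  obtains c p R where "R \<subseteq> {1..k} \<times> {1..k}" "c ` verts G = {..<n}" "port_split G k R c p"
proof -
  from assms obtain H \<pi> R h where R: "R \<subseteq> {1..k} \<times> {1..k}"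
    and H: "\<And>i. i < n \<Longrightarrow> verts (H i) \<noteq> {} \<and> \<pi> i ` verts (H i) \<subseteq> {1..k}"
    and bij: "bij_betw h (verts G) (verts (del_prod n H \<pi> R))"
    and iso: "\<And>u v. u \<in> verts G \<Longrightarrow> v \<in> verts G \<Longrightarrow>
       (u, v) \<in> edges G \<longleftrightarrow> (h u, h v) \<in> edges (del_prod n H \<pi> R)"
    unfolding cut_decomp_def graph_iso_def by metis
  define c where "c = fst \<circ> h"
  define p where "p = (\<lambda>v. \<pi> (fst (h v)) (snd (h v)))"
  have img: "h ` verts G = {(i, v). i < n \<and> v \<in> verts (H i)}"
    using bij by (simp add: bij_betw_def del_prod_def verts_def)
  have hv: "fst (h v) < n" "snd (h v) \<in> verts (H (fst (h v)))" if "v \<in> verts G" for v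
    using that img by (auto simp: set_eq_iff image_iff) (metis prod.collapse)+
  have "c ` verts G = fst ` {(i, v). i < n \<and> v \<in> verts (H i)}"
    unfolding c_def img[symmetric] by (simp add: image_comp)
  also have "\<dots> = {..<n}" using H by (force simp: image_iff)
  finally have "c ` verts G = {..<n}" .
  moreover have "port_split G k R c p"
    unfolding port_split_def
  proof (intro conjI ballI impI)
    show "p ` verts G \<subseteq> {1..k}" using hv H by (fastforce simp: p_def)
    fix u w assume "u \<in> verts G" "w \<in> verts G" "c u \<noteq> c w"
    then show "(u, w) \<in> edges G \<longleftrightarrow> (p u, p w) \<in> R \<or> (p w, p u) \<in> R"
      using hv[of u] hv[of w] iso[of u w]
      by (cases "h u"; cases "h w") (auto simp: del_prod_def edges_def[of "(_, _)"] c_def p_def)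
  qed
  ultimately show thesis using R that by blast
qed

text \<open>Operands of a decomposition live on natural numbers, so the classes of \<open>c\<close>
  are copied there by an injection \<open>g\<close>; one \<open>g\<close> serves all classes because
  \<open>del_prod\<close> tags vertices with their operand. Surjectivity of \<open>c\<close> onto
  the indices makes every operand nonempty.\<close>

lemma port_split_imp_cut_decomp:
  assumes G: "finite_graph G" and R: "R \<subseteq> {1..k} \<times> {1..k}"
    and c: "c ` verts G = {..<n}" and sp: "port_split G k R c p"
  shows "cut_decomp G k n"
proof -
  have "finite (verts G)" using G by (simp add: finite_graph_def)
  from finite_imp_inj_to_nat_seg[OF this] obtain g :: "'a \<Rightarrow> nat" where g: "inj_on g (verts G)"
    by blast
  define H where "H = (\<lambda>i. (g ` {v \<in> verts G. c v = i},
      {(g u, g w) | u w. u \<in> verts G \<and> w \<in> verts G \<and> c u = i \<and> c w = i \<and> (u, w) \<in> edges G}))"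
  define \<pi> where "\<pi> = (\<lambda>i::nat. p \<circ> inv_into (verts G) g)"
  have vH: "verts (H i) = g ` {v \<in> verts G. c v = i}" for i by (simp add: H_def verts_def)
  have eH: "(g u, g w) \<in> edges (H i) \<longleftrightarrow> c u = i \<and> c w = i \<and> (u, w) \<in> edges G"
    if "u \<in> verts G" "w \<in> verts G" for u w i
    using that g by (auto simp: H_def edges_def inj_on_eq_iff)
  have \<pi>: "\<pi> i (g v) = p v" if "v \<in> verts G" for i v
    using that g by (simp add: \<pi>_def)
  have "finite_graph (H i)" for i
  proof -
    have "sym (edges (H i))"
      using G unfolding finite_graph_def H_def edges_def sym_def by fastforce
    moreover have "irrefl (edges (H i))"
      using G g by (auto simp: finite_graph_def H_def edges_def irrefl_def inj_on_eq_iff)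
    moreover have "edges (H i) \<subseteq> verts (H i) \<times> verts (H i)"
      unfolding vH by (auto simp: H_def edges_def)
    ultimately show ?thesis using G by (simp add: finite_graph_def vH)
  qed
  moreover have "verts (H i) \<noteq> {}" if "i < n" for i
  proof -
    have "i \<in> c ` verts G" using c that by simp
    then show ?thesis unfolding vH by auto
  qed
  moreover have "\<pi> i ` verts (H i) \<subseteq> {1..k}" for i
    using sp \<pi> unfolding vH port_split_def by auto
  moreover have "graph_iso G (del_prod n H \<pi> R)"
    unfolding graph_iso_def
  proof (intro exI[of _ "\<lambda>v. (c v, g v)"] conjI ballI)
    have "(\<lambda>v. (c v, g v)) ` verts G = verts (del_prod n H \<pi> R)"
      using c by (auto simp: del_prod_def verts_def[of "(_, _)"] vH)
    then show "bij_betw (\<lambda>v. (c v, g v)) (verts G) (verts (del_prod n H \<pi> R))"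
      using g by (auto simp: bij_betw_def inj_on_def)
    fix u w assume uw: "u \<in> verts G" "w \<in> verts G"
    then have "c u < n" "c w < n" using c by auto
    moreover have "c u = c w \<or> ((u, w) \<in> edges G \<longleftrightarrow> (p u, p w) \<in> R \<or> (p w, p u) \<in> R)"
      using sp uw by (auto simp: port_split_def)
    ultimately show "(u, w) \<in> edges G \<longleftrightarrow> ((c u, g u), (c w, g w)) \<in> edges (del_prod n H \<pi> R)"
      using uw by (auto simp: del_prod_def edges_def[of "(_, _)"] vH eH \<pi>)
  qed
  ultimately show ?thesis
    using R unfolding cut_decomp_def by (intro exI[of _ H] exI[of _ \<pi>] exI[of _ R]) simp
qed

text \<open>Operands are nonempty. The bound guarantees that \<open>GREATEST\<close> in
  \<open>Cut\<close> is attained whenever some decomposition exists.\<close>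

lemma cut_decomp_le_card:
  assumes "finite (verts G)" "cut_decomp G k n"
  shows "n \<le> card (verts G)"
  using cut_decomp_imp_port_split[OF assms(2)] assms(1)
  by (metis card_image_le card_lessThan)

section \<open>From a definable linear order to a bound on the number of operands\<close>

definition root_fo :: "'v \<Rightarrow> 'v \<Rightarrow> nat \<Rightarrow> 'v" where
  "root_fo a b = (\<lambda>i. if i = 1 then b else a)"

lemma port_count_bound:
  fixes \<phi> :: mso and k m :: nat
  shows "\<exists>N. \<forall>(G :: 'v graph) P n. linear_order_on (verts G)
           {(a, b). a \<in> verts G \<and> b \<in> verts G \<and> sat_xyZ G \<phi> m a b P} \<longrightarrow>
           cut_decomp G k n \<longrightarrow> n \<le> N"
proof -
  obtain F :: "('v piece \<Rightarrow> bool) set" where F: "finite F" "composes k \<phi> F"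
    using composition by blast
  show ?thesis
  \<comment> \<open>The number of pairs of types of an operand: one type with its marked vertex as
    first argument, one with it as second argument.\<close>
  proof (intro exI[of _ "card (Pow F \<times> Pow F)"] allI impI, rule ccontr)
    fix G :: "'v graph" and P n
    assume lin: "linear_order_on (verts G)
           {(a, b). a \<in> verts G \<and> b \<in> verts G \<and> sat_xyZ G \<phi> m a b P}"
      and "cut_decomp G k n" and big: "\<not> n \<le> card (Pow F \<times> Pow F)"
    then obtain c p R where c: "c ` verts G = {..<n}" and sp: "port_split G k R c p"
      using cut_decomp_imp_port_split by metis
    define so where "so = (\<lambda>i. if i < m then P i else {})"
    have "\<forall>i\<in>{..<n}. \<exists>v. v \<in> verts G \<and> c v = i" using c by (metis imageE)
    then obtain v where v: "\<And>i. i < n \<Longrightarrow> v i \<in> verts G \<and> c (v i) = i"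
      by (metis lessThan_iff)
    \<comment> \<open>For \<open>r = True\<close> the marked vertex is the value of all variables
      except 1, for \<open>r = False\<close> of variable 1 only. This mirrors
      \<open>root_fo\<close>, where every variable other than 1 takes the value of the first
      argument.\<close>
    define Q where "Q = (\<lambda>i (r::bool). ({u \<in> verts G. c u = i}, edges G, p,
      (\<lambda>x::nat. if (x = 1) = r then None else Some (v i)),
      (\<lambda>X. so X \<inter> {u \<in> verts G. c u = i})))"
    define \<tau> where "\<tau> = (\<lambda>i. ({\<Phi> \<in> F. \<Phi> (Q i True)}, {\<Phi> \<in> F. \<Phi> (Q i False)}))"
    have "card (\<tau> ` {..<n}) \<le> card (Pow F \<times> Pow F)"
      by (rule card_mono) (use F(1) in \<open>auto simp: \<tau>_def\<close>)
    then have "\<not> inj_on \<tau> {..<n}"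
      using big by (intro pigeonhole) auto
    then obtain i j where ij: "i < n" "j < n" "i \<noteq> j" and "\<tau> i = \<tau> j"
      by (auto simp: inj_on_def)
    then have Q_eq: "\<Phi> (Q i r) \<longleftrightarrow> \<Phi> (Q j r)" if "\<Phi> \<in> F" for \<Phi> r
      using that unfolding \<tau>_def by (cases r) (auto simp: set_eq_iff)
    \<comment> \<open>Exchanging the names of operands \<open>i\<close> and \<open>j\<close> gives
      another split of the same graph. Under it, the reversed pair of marked vertices sits at the
      same indices as the original pair did.\<close>
    define c' where "c' = (\<lambda>u. if c u = i then j else if c u = j then i else c u)"
    have sp': "port_split G k R c' p"
      using sp by (auto simp: port_split_def c'_def split: if_splits)
    have ag: "agree F (piece G c p (root_fo (v i) (v j)) so l)
        (piece G c' p (root_fo (v j) (v i)) so l)" for l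
    proof -
      consider "l = i" | "l = j" | "l \<noteq> i" "l \<noteq> j" by blast
      then show ?thesis
      proof cases
        case 1
        have "piece G c p (root_fo (v i) (v j)) so l = Q i True"
          using 1 ij v by (simp add: piece_def Q_def root_fo_def fun_eq_iff)
        moreover have "piece G c' p (root_fo (v j) (v i)) so l = Q j True"
          using 1 ij v by (auto simp: piece_def Q_def root_fo_def c'_def fun_eq_iff)
        ultimately show ?thesis using Q_eq by (auto simp: agree_def)
      next
        case 2
        have "piece G c p (root_fo (v i) (v j)) so l = Q j False"
          using 2 ij v by (simp add: piece_def Q_def root_fo_def fun_eq_iff)
        moreover have "piece G c' p (root_fo (v j) (v i)) so l = Q i False"
          using 2 ij v by (auto simp: piece_def Q_def root_fo_def c'_def fun_eq_iff)
        ultimately show ?thesis using Q_eq by (auto simp: agree_def)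
      next
        case 3
        then have "{u \<in> verts G. c' u = l} = {u \<in> verts G. c u = l}" by (auto simp: c'_def)
        moreover have "c (root_fo (v i) (v j) x) \<noteq> l" "c' (root_fo (v j) (v i) x) \<noteq> l" for x
          using 3 ij v by (auto simp: root_fo_def c'_def)
        ultimately show ?thesis by (simp add: piece_def agree_def)
      qed
    qed
    have fo: "root_fo (v i) (v j) x \<in> verts G" "root_fo (v j) (v i) x \<in> verts G" for x
      using ij v by (auto simp: root_fo_def)
    have "sat_xyZ G \<phi> m (v i) (v j) P \<longleftrightarrow> sat_xyZ G \<phi> m (v j) (v i) P"
      using composesD[OF F(2) sp sp' fo ag] composesD[OF F(2) sp' sp fo(2,1) agree_sym[OF ag]]
      unfolding sat_xyZ_def so_def root_fo_def by blast
    moreover have "v i \<noteq> v j" using ij v by metis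
    ultimately show False
      using lin ij v unfolding linear_order_on_def partial_order_on_def total_on_def antisym_def
      by blast
  qed
qed

text \<open>If there is no decomposition at all, as for \<open>k = 0\<close>, then \<open>Cut\<close> is the unspecified value
  of \<open>GREATEST\<close> on the empty predicate, which at least does not depend on the graph.\<close>

lemma Cut_le:
  assumes "finite (verts G)" "\<And>n. cut_decomp G k n \<Longrightarrow> n \<le> N"
  shows "Cut G k \<le> max N (GREATEST n::nat. False)"
proof (cases "\<exists>n. cut_decomp G k n")
  case True
  then have "cut_decomp G k (Cut G k)"
    unfolding Cut_def using cut_decomp_le_card[OF assms(1)] by (metis GreatestI_nat)
  then show ?thesis using assms(2) by fastforce
next
  case False
  then have "cut_decomp G k = (\<lambda>n. False)" by auto
  then show ?thesis by (simp add: Cut_def)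
qed

lemma orderable_imp_CUT:
  fixes C :: "'v graph set"
  assumes fin: "\<And>G. G \<in> C \<Longrightarrow> finite (verts G)" and ne: "\<And>G. G \<in> C \<Longrightarrow> verts G \<noteq> {}"
    and "mso_orderable C"
  shows "has_CUT C"
proof -
  from assms(3) obtain \<phi> m where lin: "\<And>G. G \<in> C \<Longrightarrow> \<exists>P. linear_order_on (verts G)
          {(a, b). a \<in> verts G \<and> b \<in> verts G \<and> sat_xyZ G \<phi> m a b P}"
    using ne unfolding mso_orderable_def by meson
  have "\<forall>k. \<exists>N. \<forall>(G :: 'v graph) P n. linear_order_on (verts G)
           {(a, b). a \<in> verts G \<and> b \<in> verts G \<and> sat_xyZ G \<phi> m a b P} \<longrightarrow>
           cut_decomp G k n \<longrightarrow> n \<le> N"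
    using port_count_bound by blast
  from choice[OF this] obtain N where N: "\<forall>k (G :: 'v graph) P n. linear_order_on (verts G)
           {(a, b). a \<in> verts G \<and> b \<in> verts G \<and> sat_xyZ G \<phi> m a b P} \<longrightarrow>
           cut_decomp G k n \<longrightarrow> n \<le> N k"
    by blast
  have "Cut G k \<le> max (N k) (GREATEST n::nat. False)" if "G \<in> C" for G k
    using lin[OF that] N by (intro Cut_le fin that) blast
  then show ?thesis
    unfolding has_CUT_def by (intro exI[of _ "\<lambda>k. max (N k) (GREATEST n::nat. False)"]) auto
qed

section \<open>Cotrees\<close>

lemma leaves_nonempty: "wf_cotree t \<Longrightarrow> leaves t \<noteq> {}"
proof (induction t)
  case (Node b ts)
  then have "hd ts \<in> set ts" by (cases ts) auto
  then show ?case using Node by fastforce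
qed simp

lemma finite_leaves: "finite (leaves t)"
  by (induction t) auto

lemma cotree_edges_subset: "cotree_edges t \<subseteq> leaves t \<times> leaves t"
proof (induction t)
  case (Node b ts)
  then show ?case by (fastforce dest: nth_mem split: if_splits)
qed simp

lemma sym_cotree_edges: "sym (cotree_edges t)"
proof (induction t)
  case (Node b ts)
  then show ?case by (fastforce simp: sym_def)
qed (simp add: sym_def)

lemma leaves_nth_subset: "i < length ts \<Longrightarrow> leaves (ts ! i) \<subseteq> leaves (Node b ts)"
  by (auto dest: nth_mem)

lemma leaves_NodeE:
  assumes "v \<in> leaves (Node b ts)"
  obtains i where "i < length ts" "v \<in> leaves (ts ! i)"
  using assms by (auto simp: in_set_conv_nth)

lemma child_unique:
  assumes "wf_cotree (Node b ts)" "i < length ts" "j < length ts"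
    "v \<in> leaves (ts ! i)" "v \<in> leaves (ts ! j)"
  shows "i = j"
proof (rule ccontr)
  assume "i \<noteq> j"
  then have "leaves (ts ! i) \<inter> leaves (ts ! j) = {}" using assms(1-3) by simp
  then show False using assms(4,5) by blast
qed

definition child_index :: "'v cotree list \<Rightarrow> 'v \<Rightarrow> nat" where
  "child_index ts v = (LEAST i. i < length ts \<and> v \<in> leaves (ts ! i))"

lemma child_index_eq:
  assumes "wf_cotree (Node b ts)" "i < length ts" "v \<in> leaves (ts ! i)"
  shows "child_index ts v = i"
  unfolding child_index_def using assms child_unique[OF assms(1)]
  by (intro Least_equality) auto

lemma cotree_edges_child:
  assumes "wf_cotree (Node b ts)" "i < length ts" "u \<in> leaves (ts ! i)" "w \<in> leaves (ts ! i)"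
  shows "(u, w) \<in> cotree_edges (Node b ts) \<longleftrightarrow> (u, w) \<in> cotree_edges (ts ! i)"
proof
  assume "(u, w) \<in> cotree_edges (Node b ts)"
  then consider t where "t \<in> set ts" "(u, w) \<in> cotree_edges t"
    | j k where "j < length ts" "k < length ts" "j \<noteq> k" "u \<in> leaves (ts ! j)" "w \<in> leaves (ts ! k)"
    by (auto split: if_splits)
  then show "(u, w) \<in> cotree_edges (ts ! i)"
  proof cases
    case 1
    then obtain j where j: "j < length ts" "t = ts ! j" by (auto simp: in_set_conv_nth)
    then have "u \<in> leaves (ts ! j)" using 1 cotree_edges_subset by blast
    then show ?thesis using 1 j child_unique[OF assms(1,2) j(1) assms(3)] by auto
  next
    case 2
    then show ?thesis
      using child_unique[OF assms(1,2) 2(1) assms(3)] child_unique[OF assms(1,2) 2(2) assms(4)]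
      by auto
  qed
qed (use assms in auto)

lemma cotree_edges_cross:
  assumes "wf_cotree (Node b ts)" "i < length ts" "j < length ts" "i \<noteq> j"
    "u \<in> leaves (ts ! i)" "w \<in> leaves (ts ! j)"
  shows "(u, w) \<in> cotree_edges (Node b ts) \<longleftrightarrow> b"
proof
  assume e: "(u, w) \<in> cotree_edges (Node b ts)"
  show b
  proof (rule ccontr)
    assume "\<not> b"
    with e obtain t where "t \<in> set ts" "(u, w) \<in> cotree_edges t" by auto
    then obtain k where k: "k < length ts" "(u, w) \<in> cotree_edges (ts ! k)"
      by (auto simp: in_set_conv_nth)
    then have "u \<in> leaves (ts ! k)" "w \<in> leaves (ts ! k)" using cotree_edges_subset by blast+
    then show False
      using child_unique[OF assms(1,2) k(1) assms(5)] child_unique[OF assms(1,3) k(1) assms(6)]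
        assms(4) by auto
  qed
qed (use assms in auto)

lemma irrefl_cotree_edges: "wf_cotree t \<Longrightarrow> (v, v) \<notin> cotree_edges t"
proof (induction t)
  case (Node b ts)
  show ?case
  proof
    assume v: "(v, v) \<in> cotree_edges (Node b ts)"
    then have "v \<in> leaves (Node b ts)" using cotree_edges_subset by blast
    then obtain i where i: "i < length ts" "v \<in> leaves (ts ! i)" by (rule leaves_NodeE)
    then have "(v, v) \<in> cotree_edges (ts ! i)" using cotree_edges_child[OF Node.prems] v by blast
    then show False using Node i by simp
  qed
qed simp

lemma finite_graph_cotree_graph: "wf_cotree t \<Longrightarrow> finite_graph (cotree_graph t)"
  using finite_leaves[of t] cotree_edges_subset[of t] sym_cotree_edges[of t]
    irrefl_cotree_edges[of t]
  by (simp add: finite_graph_def cotree_graph_def verts_def edges_def irrefl_def)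

lemma wf_cotree_child: "wf_cotree (Node b ts) \<Longrightarrow> i < length ts \<Longrightarrow> wf_cotree (ts ! i)"
  by simp

lemma child_outdeg_le: "i < length ts \<Longrightarrow> outdeg (ts ! i) \<le> outdeg (Node b ts)"
  by (simp add: max.coboundedI2)

section \<open>Every cograph has a cotree: binary operations flattened to alternating ones\<close>

fun parts :: "bool \<Rightarrow> 'v cotree \<Rightarrow> 'v cotree list" where
  "parts b (Leaf v) = [Leaf v]"
| "parts b (Node c ts) = (if b = c then ts else [Node c ts])"

definition cross :: "'v cotree list \<Rightarrow> ('v \<times> 'v) set" where
  "cross ts = {(u, w). \<exists>i<length ts. \<exists>j<length ts. i \<noteq> j \<and>
     u \<in> leaves (ts ! i) \<and> w \<in> leaves (ts ! j)}"

lemma cross_append: "cross (xs @ ys) = cross xs \<union> cross ys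
    \<union> (\<Union>(leaves ` set xs)) \<times> (\<Union>(leaves ` set ys)) \<union> (\<Union>(leaves ` set ys)) \<times> (\<Union>(leaves ` set xs))"
  (is "?L = ?R")
proof (intro equalityI subrelI)
  fix u w assume "(u, w) \<in> ?L"
  then obtain i j where ij: "i < length (xs @ ys)" "j < length (xs @ ys)" "i \<noteq> j"
    "u \<in> leaves ((xs @ ys) ! i)" "w \<in> leaves ((xs @ ys) ! j)"
    by (auto simp: cross_def)
  let ?n = "length xs"
  consider "i < ?n" "j < ?n" | "i < ?n" "\<not> j < ?n" | "\<not> i < ?n" "j < ?n" | "\<not> i < ?n" "\<not> j < ?n"
    by blast
  then show "(u, w) \<in> ?R"
  proof cases
    case 1
    then have "(u, w) \<in> cross xs" using ij by (auto simp: cross_def nth_append)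
    then show ?thesis by blast
  next
    case 2
    then have "xs ! i \<in> set xs" "ys ! (j - ?n) \<in> set ys" using ij by auto
    then show ?thesis using 2 ij by (auto simp: nth_append)
  next
    case 3
    then have "xs ! j \<in> set xs" "ys ! (i - ?n) \<in> set ys" using ij by auto
    then show ?thesis using 3 ij by (auto simp: nth_append)
  next
    case 4
    then have "i - ?n < length ys" "j - ?n < length ys" "i - ?n \<noteq> j - ?n" using ij by auto
    then have "(u, w) \<in> cross ys" using 4 ij unfolding cross_def by (auto simp: nth_append)
    then show ?thesis by blast
  qed
next
  fix u w assume "(u, w) \<in> ?R"
  moreover have "(u, w) \<in> ?L" if "(u, w) \<in> cross xs"
  proof -
    from that obtain i j where "i < length xs" "j < length xs" "i \<noteq> j"
      "u \<in> leaves (xs ! i)" "w \<in> leaves (xs ! j)" by (auto simp: cross_def)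
    then have "i < length (xs @ ys)" "j < length (xs @ ys)" "i \<noteq> j"
      "u \<in> leaves ((xs @ ys) ! i)" "w \<in> leaves ((xs @ ys) ! j)"
      by (auto simp: nth_append)
    then show ?thesis unfolding cross_def by blast
  qed
  moreover have "(u, w) \<in> ?L" if "(u, w) \<in> cross ys"
  proof -
    from that obtain i j where "i < length ys" "j < length ys" "i \<noteq> j"
      "u \<in> leaves (ys ! i)" "w \<in> leaves (ys ! j)" by (auto simp: cross_def)
    then have "length xs + i < length (xs @ ys)" "length xs + j < length (xs @ ys)"
      "length xs + i \<noteq> length xs + j" "u \<in> leaves ((xs @ ys) ! (length xs + i))"
      "w \<in> leaves ((xs @ ys) ! (length xs + j))"
      by (auto simp: nth_append)
    then show ?thesis unfolding cross_def by blast
  qed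
  moreover have "(u, w) \<in> ?L \<and> (w, u) \<in> ?L"
    if "u \<in> \<Union>(leaves ` set xs)" "w \<in> \<Union>(leaves ` set ys)" for u w
  proof -
    from that obtain i j where "i < length xs" "j < length ys"
      "u \<in> leaves (xs ! i)" "w \<in> leaves (ys ! j)" by (auto simp: in_set_conv_nth)
    then have "i < length (xs @ ys)" "length xs + j < length (xs @ ys)" "i \<noteq> length xs + j"
      "u \<in> leaves ((xs @ ys) ! i)" "w \<in> leaves ((xs @ ys) ! (length xs + j))"
      by (auto simp: nth_append)
    then show ?thesis unfolding cross_def by blast
  qed
  ultimately show "(u, w) \<in> ?L" by blast
qed

lemma cross_singleton: "cross [t] = {}"
  by (simp add: cross_def)

lemma cotree_edges_Node:
  "cotree_edges (Node b ts) = (\<Union>(cotree_edges ` set ts)) \<union> (if b then cross ts else {})"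
  by (simp add: cross_def)

lemma leaves_parts: "\<Union>(leaves ` set (parts b t)) = leaves t"
  by (cases t) auto

lemma edges_parts:
  "(\<Union>(cotree_edges ` set (parts b t))) \<union> (if b then cross (parts b t) else {}) = cotree_edges t"
  by (cases t) (auto simp: cross_singleton cotree_edges_Node simp del: cotree_edges.simps(2))

lemma wf_parts: "wf_cotree t \<Longrightarrow> t' \<in> set (parts b t) \<Longrightarrow> wf_cotree t' \<and> \<not> is_op b t'"
  by (cases t) (auto split: if_splits)

lemma parts_nonempty: "wf_cotree t \<Longrightarrow> parts b t \<noteq> []"
  by (cases t) auto

lemma disjoint_parts:
  "wf_cotree t \<Longrightarrow> i < length (parts b t) \<Longrightarrow> j < length (parts b t) \<Longrightarrow> i \<noteq> j \<Longrightarrow>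
    leaves (parts b t ! i) \<inter> leaves (parts b t ! j) = {}"
  by (cases t) (simp_all split: if_splits)

text \<open>An argument whose root already carries \<open>b\<close> is dissolved into its children,
  which preserves the alternation of the operations.\<close>

definition combine :: "bool \<Rightarrow> 'v cotree \<Rightarrow> 'v cotree \<Rightarrow> 'v cotree" where
  "combine b s t = Node b (parts b s @ parts b t)"

lemma leaves_combine: "leaves (combine b s t) = leaves s \<union> leaves t"
  using leaves_parts[of b s] leaves_parts[of b t] by (simp add: combine_def)

lemma cotree_edges_combine: "cotree_edges (combine b s t) = cotree_edges s \<union> cotree_edges t \<union>
    (if b then leaves s \<times> leaves t \<union> leaves t \<times> leaves s else {})"
proof -
  have "cotree_edges (combine b s t) =
      ((\<Union>(cotree_edges ` set (parts b s))) \<union> (if b then cross (parts b s) else {})) \<union>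
      ((\<Union>(cotree_edges ` set (parts b t))) \<union> (if b then cross (parts b t) else {})) \<union>
      (if b then leaves s \<times> leaves t \<union> leaves t \<times> leaves s else {})"
    unfolding combine_def cotree_edges_Node by (auto simp: cross_append leaves_parts)
  then show ?thesis by (simp only: edges_parts)
qed

lemma wf_combine:
  assumes "wf_cotree s" "wf_cotree t" "leaves s \<inter> leaves t = {}"
  shows "wf_cotree (combine b s t)"
proof -
  let ?xs = "parts b s" and ?ys = "parts b t"
  have "leaves ((?xs @ ?ys) ! i) \<inter> leaves ((?xs @ ?ys) ! j) = {}"
    if ij: "i < length (?xs @ ?ys)" "j < length (?xs @ ?ys)" "i \<noteq> j" for i j
  proof -
    have xs: "leaves (?xs ! k) \<subseteq> leaves s" if "k < length ?xs" for k
      using leaves_parts[of b s] that by (metis UN_upper nth_mem)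
    have ys: "leaves (?ys ! k) \<subseteq> leaves t" if "k < length ?ys" for k
      using leaves_parts[of b t] that by (metis UN_upper nth_mem)
    let ?n = "length ?xs"
    consider "i < ?n" "j < ?n" | "i < ?n" "\<not> j < ?n" | "\<not> i < ?n" "j < ?n" | "\<not> i < ?n" "\<not> j < ?n"
      by blast
    then show ?thesis
    proof cases
      case 1
      then show ?thesis using ij disjoint_parts[OF assms(1)] by (simp add: nth_append)
    next
      case 2
      moreover then have "leaves (?ys ! (j - ?n)) \<subseteq> leaves t" using ij by (intro ys) auto
      ultimately show ?thesis using ij xs[of i] assms(3) by (auto simp: nth_append)
    next
      case 3
      moreover then have "leaves (?ys ! (i - ?n)) \<subseteq> leaves t" using ij by (intro ys) auto
      ultimately show ?thesis using ij xs[of j] assms(3) by (auto simp: nth_append)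
    next
      case 4
      then show ?thesis
        using ij disjoint_parts[OF assms(2), of "i - ?n" b "j - ?n"] by (simp add: nth_append)
    qed
  qed
  moreover have "length (?xs @ ?ys) \<ge> 2"
    using parts_nonempty[OF assms(1), of b] parts_nonempty[OF assms(2), of b]
    by (cases ?xs; cases ?ys) auto
  ultimately show ?thesis
    using wf_parts[OF assms(1)] wf_parts[OF assms(2)] unfolding combine_def by auto
qed

lemma cograph_cotree: "cograph G \<Longrightarrow> \<exists>t. wf_cotree t \<and> cotree_graph t = G"
proof (induction rule: cograph.induct)
  case (single v)
  show ?case by (rule exI[of _ "Leaf v"]) (simp add: cotree_graph_def)
next
  case (union V1 E1 V2 E2)
  then obtain s t where "wf_cotree s" "cotree_graph s = (V1, E1)"
    "wf_cotree t" "cotree_graph t = (V2, E2)" by blast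
  then show ?case using union.hyps
    by (intro exI[of _ "combine False s t"])
      (auto simp: cotree_graph_def leaves_combine cotree_edges_combine intro: wf_combine)
next
  case (join V1 E1 V2 E2)
  then obtain s t where "wf_cotree s" "cotree_graph s = (V1, E1)"
    "wf_cotree t" "cotree_graph t = (V2, E2)" by blast
  then show ?case using join.hyps
    by (intro exI[of _ "combine True s t"])
      (auto simp: cotree_graph_def leaves_combine cotree_edges_combine intro: wf_combine)
qed

section \<open>Splitting a cograph at a node of its cotree\<close>

text \<open>The induction descends to a node of maximal outdegree and carries the invariant needed
  on the way back up: only class 0 ever receives outside vertices, so every other class has port 1
  throughout. Ports 2 and 3 are kept for outside vertices adjacent or not adjacent to the node, and
  \<open>R\<close> already treats port 1 accordingly.\<close>

lemma outdeg_port_split: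
  assumes "wf_cotree t" "0 < outdeg t"
  shows "\<exists>c p R. R \<subseteq> {1..3} \<times> {1..3} \<and> c ` leaves t = {..<outdeg t} \<and>
    port_split (cotree_graph t) 3 R c p \<and> (\<forall>v\<in>leaves t. c v \<noteq> 0 \<longrightarrow> p v = 1) \<and>
    (1, 2) \<in> R \<and> (1, 3) \<notin> R \<and> (3, 1) \<notin> R"
  using assms
proof (induction t)
  case (Node b ts)
  have "outdeg (Node b ts) = length ts \<or> outdeg (Node b ts) \<in> outdeg ` set ts"
    using Node.prems Max_in[of "insert 0 (outdeg ` set ts)"] by (auto simp: max_def split: if_splits)
  then show ?case
  proof
    assume d: "outdeg (Node b ts) = length ts"
    \<comment> \<open>The pair \<open>(1, 1)\<close> encodes the edges between children;
      \<open>(1, 2)\<close> only prepares for the ancestors, as no vertex has port 2 yet.\<close>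
    let ?R = "(if b then {(1, 1), (1, 2)} else {(1, 2)}) :: (nat \<times> nat) set"
    show ?thesis
    proof (rule exI[of _ "child_index ts"], rule exI[of _ "\<lambda>_. 1"], rule exI[of _ ?R], intro conjI)
      show "child_index ts ` leaves (Node b ts) = {..<outdeg (Node b ts)}"
        unfolding d
      proof (intro equalityI subsetI)
        fix i assume "i \<in> child_index ts ` leaves (Node b ts)"
        then show "i \<in> {..<length ts}"
          using child_index_eq[OF Node.prems(1)] by (auto elim!: leaves_NodeE simp del: leaves.simps)
      next
        fix i assume i: "i \<in> {..<length ts}"
        then obtain v where "v \<in> leaves (ts ! i)"
          using leaves_nonempty[OF wf_cotree_child[OF Node.prems(1)]] by blast
        then show "i \<in> child_index ts ` leaves (Node b ts)"
          using i child_index_eq[OF Node.prems(1)] leaves_nth_subset[of i ts b]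
          by (metis image_eqI lessThan_iff subsetD)
      qed
      show "port_split (cotree_graph (Node b ts)) 3 ?R (child_index ts) (\<lambda>_. 1)"
        unfolding port_split_def
      proof (intro conjI ballI impI)
        fix u w
        assume "u \<in> verts (cotree_graph (Node b ts))" "w \<in> verts (cotree_graph (Node b ts))"
          and ne: "child_index ts u \<noteq> child_index ts w"
        then have "u \<in> leaves (Node b ts)" "w \<in> leaves (Node b ts)"
          by (simp_all add: cotree_graph_def verts_def)
        then obtain i j where ij: "i < length ts" "u \<in> leaves (ts ! i)"
          "j < length ts" "w \<in> leaves (ts ! j)" by (meson leaves_NodeE)
        then have "i \<noteq> j" using ne child_index_eq[OF Node.prems(1)] by metis
        then have "(u, w) \<in> cotree_edges (Node b ts) \<longleftrightarrow> b"
          using cotree_edges_cross[OF Node.prems(1)] ij by blast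
        then show "(u, w) \<in> edges (cotree_graph (Node b ts)) \<longleftrightarrow> (1, 1) \<in> ?R \<or> (1, 1) \<in> ?R"
          by (simp add: cotree_graph_def edges_def)
      qed auto
    qed auto
  next
    assume "outdeg (Node b ts) \<in> outdeg ` set ts"
    then obtain i where i: "i < length ts" and d: "outdeg (Node b ts) = outdeg (ts ! i)"
      by (auto simp: in_set_conv_nth)
    let ?s = "ts ! i"
    have wf: "wf_cotree ?s" using Node.prems i by simp
    then obtain c p R where R: "R \<subseteq> {1..3} \<times> {1..3}" "(1, 2) \<in> R" "(1, 3) \<notin> R" "(3, 1) \<notin> R"
      and c: "c ` leaves ?s = {..<outdeg ?s}"
      and sp: "port_split (cotree_graph ?s) 3 R c p" and cp: "\<forall>v\<in>leaves ?s. c v \<noteq> 0 \<longrightarrow> p v = 1"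
      using Node.IH[of ?s] i Node.prems(2) d by fastforce
    \<comment> \<open>Vertices outside the child join class 0. Their edges among each other and to
      the rest of class 0 are internal to that operand, so only pairs with port 1 on the child's
      side have to be right.\<close>
    define c' where "c' = (\<lambda>v. if v \<in> leaves ?s then c v else 0)"
    define p' where "p' = (\<lambda>v. if v \<in> leaves ?s then p v else if b then 2 else 3)"
    have sub: "leaves ?s \<subseteq> leaves (Node b ts)" using i by (rule leaves_nth_subset)
    have out: "(u, w) \<in> cotree_edges (Node b ts) \<longleftrightarrow> b" "(w, u) \<in> cotree_edges (Node b ts) \<longleftrightarrow> b"
      if "u \<in> leaves ?s" "w \<in> leaves (Node b ts)" "w \<notin> leaves ?s" for u w
    proof -
      obtain j where "j < length ts" "w \<in> leaves (ts ! j)"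
        using \<open>w \<in> leaves (Node b ts)\<close> by (rule leaves_NodeE)
      moreover then have "i \<noteq> j" using that by auto
      ultimately show "(u, w) \<in> cotree_edges (Node b ts) \<longleftrightarrow> b" "(w, u) \<in> cotree_edges (Node b ts) \<longleftrightarrow> b"
        using cotree_edges_cross[OF Node.prems(1)] i that(1) by blast+
    qed
    have "c' ` leaves (Node b ts) = {..<outdeg ?s}"
    proof -
      have "c' ` leaves ?s = {..<outdeg ?s}" using c by (simp add: c'_def)
      moreover have "c' v \<in> {..<outdeg ?s}" if "v \<in> leaves (Node b ts)" for v
        using c Node.prems(2) d by (auto simp: c'_def simp del: outdeg.simps)
      ultimately show ?thesis using sub by blast
    qed
    moreover have "port_split (cotree_graph (Node b ts)) 3 R c' p'"
      unfolding port_split_def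
    proof (intro conjI ballI impI)
      have "p v \<in> {1..3}" if "v \<in> leaves ?s" for v
        using sp that unfolding port_split_def cotree_graph_def verts_def by auto
      then show "p' ` verts (cotree_graph (Node b ts)) \<subseteq> {1..3}"
        by (auto simp: p'_def)
      fix u w
      assume "u \<in> verts (cotree_graph (Node b ts))" "w \<in> verts (cotree_graph (Node b ts))"
        and ne: "c' u \<noteq> c' w"
      then have uw: "u \<in> leaves (Node b ts)" "w \<in> leaves (Node b ts)"
        by (simp_all add: cotree_graph_def verts_def)
      have "(u, w) \<in> cotree_edges (Node b ts) \<longleftrightarrow> (p' u, p' w) \<in> R \<or> (p' w, p' u) \<in> R"
      proof (cases "u \<in> leaves ?s"; cases "w \<in> leaves ?s")
        assume "u \<in> leaves ?s" "w \<in> leaves ?s"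
        then show ?thesis
          using sp ne cotree_edges_child[OF Node.prems(1) i]
          by (simp add: port_split_def cotree_graph_def verts_def edges_def c'_def p'_def
              del: cotree_edges.simps)
      next
        assume u: "u \<in> leaves ?s" and w: "w \<notin> leaves ?s"
        then have "p' u = 1" using ne cp by (auto simp: c'_def p'_def)
        then show ?thesis using out[OF u uw(2) w] w R by (simp add: p'_def)
      next
        assume u: "u \<notin> leaves ?s" and w: "w \<in> leaves ?s"
        then have "p' w = 1" using ne cp by (auto simp: c'_def p'_def)
        then show ?thesis using out[OF w uw(1) u] u R by (simp add: p'_def)
      next
        assume "u \<notin> leaves ?s" "w \<notin> leaves ?s"
        then show ?thesis using ne by (simp add: c'_def)
      qed
      then show "(u, w) \<in> edges (cotree_graph (Node b ts)) \<longleftrightarrow> (p' u, p' w) \<in> R \<or> (p' w, p' u) \<in> R"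
        by (simp add: cotree_graph_def edges_def)
    qed
    moreover have "\<forall>v\<in>leaves (Node b ts). c' v \<noteq> 0 \<longrightarrow> p' v = 1"
      using cp by (simp add: c'_def p'_def)
    ultimately show ?thesis using R unfolding d by blast
  qed
qed simp

lemma outdeg_le_Cut:
  assumes "wf_cotree t"
  shows "outdeg t \<le> Cut (cotree_graph t) 3"
proof (cases "outdeg t = 0")
  case False
  let ?G = "cotree_graph t"
  have G: "finite_graph ?G" "verts ?G = leaves t"
    using finite_graph_cotree_graph[OF assms] by (simp_all add: cotree_graph_def verts_def)
  from False outdeg_port_split[OF assms] obtain c p R
    where "R \<subseteq> {1..3} \<times> {1..3}" "c ` verts ?G = {..<outdeg t}" "port_split ?G 3 R c p"
    unfolding G(2) by blast
  then have "cut_decomp ?G 3 (outdeg t)"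
    by (intro port_split_imp_cut_decomp[OF G(1)])
  moreover have "n \<le> card (verts ?G)" if "cut_decomp ?G 3 n" for n
    using cut_decomp_le_card[OF _ that] G(1) by (simp add: finite_graph_def)
  ultimately show ?thesis unfolding Cut_def by (metis Greatest_le_nat)
qed simp

lemma CUT_imp_bounded:
  assumes "has_CUT C"
  shows "bounded_cotree_outdeg C"
proof -
  from assms obtain f where "\<And>G k. G \<in> C \<Longrightarrow> Cut G k \<le> f k" by (auto simp: has_CUT_def)
  then show ?thesis
    unfolding bounded_cotree_outdeg_def
    by (intro exI[of _ "f 3"]) (use outdeg_le_Cut le_trans in blast)
qed

section \<open>Leaf labellings that distinguish siblings\<close>

text \<open>All and-or evaluations at once, one per parameter: \<open>i \<in> l v\<close> means that
  the vertex \<open>v\<close> belongs to the parameter with index \<open>i\<close>.\<close>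

fun tree_val :: "('v \<Rightarrow> nat set) \<Rightarrow> 'v cotree \<Rightarrow> nat set" where
  "tree_val l (Leaf v) = l v"
| "tree_val l (Node b ts) = (if b then \<Inter>t\<in>set ts. tree_val l t else \<Union>t\<in>set ts. tree_val l t)"

fun distinguished :: "nat \<Rightarrow> ('v \<Rightarrow> nat set) \<Rightarrow> 'v cotree \<Rightarrow> bool" where
  "distinguished n l (Leaf v) \<longleftrightarrow> True"
| "distinguished n l (Node b ts) \<longleftrightarrow> (\<forall>t\<in>set ts. distinguished n l t) \<and>
     (\<forall>i<length ts. \<forall>j<length ts. i \<noteq> j \<longrightarrow>
        tree_val l (ts ! i) \<inter> {..<n} \<noteq> tree_val l (ts ! j) \<inter> {..<n})"

lemma tree_val_cong: "(\<And>v. v \<in> leaves t \<Longrightarrow> l v = l' v) \<Longrightarrow> tree_val l t = tree_val l' t"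
proof (induction t)
  case (Node b ts)
  then have "\<forall>t\<in>set ts. tree_val l t = tree_val l' t" by (metis UN_I leaves.simps(2))
  then show ?case by simp
qed simp

lemma distinguished_cong:
  "(\<And>v. v \<in> leaves t \<Longrightarrow> l v = l' v) \<Longrightarrow> distinguished n l t = distinguished n l' t"
proof (induction t)
  case (Node b ts)
  then have "\<forall>t\<in>set ts. distinguished n l t = distinguished n l' t"
    by (metis UN_I leaves.simps(2))
  moreover have "\<forall>t\<in>set ts. tree_val l t = tree_val l' t"
    using Node.prems by (metis UN_I leaves.simps(2) tree_val_cong)
  ultimately show ?case by simp
qed simp

text \<open>Two sets of size at most \<open>w\<close> already cover \<open>c\<close>; singletons pad
  the family to exactly \<open>m\<close> distinct members.\<close>

lemma cover_by_small_sets: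
  assumes c: "finite c" "w \<le> card c" "card c \<le> 2 * w" and m: "2 \<le> m" "m \<le> w"
  shows "\<exists>a. inj_on a {..<m} \<and> (\<forall>i<m. a i \<subseteq> c \<and> card (a i) \<le> w) \<and> (\<Union>i<m. a i) = (c :: nat set)"
proof -
  obtain A where A: "A \<subseteq> c" "card A = w" "finite A"
    using obtain_subset_with_card_n[OF c(2)] c(1) by (metis finite_subset)
  define B where "B = c - A"
  have B: "card B \<le> w" using A c by (simp add: B_def card_Diff_subset)
  \<comment> \<open>The \<open>w\<close> singletons ensure that at least \<open>m\<close> candidates
    are available, whether or not some of them coincide with \<open>A\<close> or
    \<open>B\<close>.\<close>
  let ?F = "{A, B} \<union> (\<lambda>x. {x}) ` A"
  have "card ((\<lambda>x. {x}) ` A) = w" using A by (simp add: card_image)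
  moreover have "card ((\<lambda>x. {x}) ` A) \<le> card ?F" using A(3) by (intro card_mono) auto
  ultimately have "m \<le> card ?F" using m(2) by simp
  moreover have "card {A, B} \<le> m" using m(1) by (simp add: card_insert_if)
  ultimately obtain S where S: "{A, B} \<subseteq> S" "S \<subseteq> ?F" "card S = m"
    using exists_subset_between[of "{A, B}" m ?F] A(3) by auto
  moreover have "finite S" using S(2) A(3) by (auto intro: finite_subset)
  ultimately obtain a where a: "bij_betw a {..<m} S"
    using ex_bij_betw_nat_finite[of S] by (auto simp: lessThan_atLeast0)
  have "X \<subseteq> c \<and> card X \<le> w" if "X \<in> S" for X
    using that S(2) A B m by (auto simp: B_def)
  moreover have "\<Union>S = c" using S A by (auto simp: B_def)
  ultimately show ?thesis using a unfolding bij_betw_def by (intro exI[of _ a]) auto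
qed

text \<open>A disjunctive node is the union of distinct small sets as soon as its value is large,
  dually for conjunctive nodes; since the operations alternate along a branch, the two size
  conditions never meet at the same node.\<close>

lemma labelling_exists:
  assumes "wf_cotree t" "outdeg t \<le> w" "c \<subseteq> {..<2 * w}"
    "is_op False t \<Longrightarrow> w \<le> card c" "is_op True t \<Longrightarrow> card c \<le> w"
  shows "\<exists>l. tree_val l t = c \<and> distinguished (2 * w) l t"
  using assms
proof (induction t arbitrary: c)
  case (Leaf v)
  show ?case by (rule exI[of _ "\<lambda>_. c"]) simp
next
  case (Node b ts)
  let ?m = "length ts" and ?U = "{..<2 * w}"
  have m: "2 \<le> ?m" "?m \<le> w" using Node.prems(1,2) by auto
  have compl: "card (?U - X) = 2 * w - card X" if "X \<subseteq> ?U" for X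
    using that by (simp add: card_Diff_subset finite_subset[OF that])
  have "\<exists>a. inj_on a {..<?m} \<and> (\<forall>i<?m. a i \<subseteq> ?U \<and> (if b then w \<le> card (a i) else card (a i) \<le> w))
      \<and> (if b then (\<Inter>i<?m. a i) else (\<Union>i<?m. a i)) = c"
  proof (cases b)
    case False
    moreover have "finite c" "card c \<le> 2 * w"
      using Node.prems(3) card_mono[of ?U c] by (auto intro: finite_subset)
    moreover have "w \<le> card c" using Node.prems(4) False by simp
    ultimately show ?thesis
      using cover_by_small_sets[of c w ?m] m Node.prems(3) by (auto; blast)
  next
    case True
    \<comment> \<open>De Morgan: the complement of \<open>c\<close> is covered by small sets, and
      their complements, all of size at least \<open>w\<close>, intersect in
      \<open>c\<close>.\<close>
    let ?c = "?U - c"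
    have "card ?c = 2 * w - card c" by (rule compl[OF Node.prems(3)])
    moreover have "card c \<le> w" using Node.prems(5) True by simp
    ultimately have "finite ?c" "w \<le> card ?c" "card ?c \<le> 2 * w" by auto
    from cover_by_small_sets[OF this m] obtain a where a: "inj_on a {..<?m}"
      "\<forall>i<?m. a i \<subseteq> ?c \<and> card (a i) \<le> w" "(\<Union>i<?m. a i) = ?c"
      by blast
    have sub: "a i \<subseteq> ?U" if "i < ?m" for i using a(2) that by blast
    have "inj_on (\<lambda>i. ?U - a i) {..<?m}"
      using a(1) sub unfolding inj_on_def by (metis double_diff lessThan_iff subset_refl)
    moreover have "w \<le> card (?U - a i)" if "i < ?m" for i
    proof -
      have "card (a i) \<le> w" using a(2) that by blast
      then show ?thesis using compl[OF sub[OF that]] by simp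
    qed
    moreover have "(\<Inter>i<?m. ?U - a i) = c"
    proof -
      have "0 \<in> {..<?m}" using m by (simp only: lessThan_iff)
      then have "(\<Inter>i<?m. ?U - a i) = ?U - (\<Union>i<?m. a i)" by blast
      also have "\<dots> = c" unfolding a(3) using Node.prems(3) by blast
      finally show ?thesis .
    qed
    ultimately show ?thesis using True by (intro exI[of _ "\<lambda>i. ?U - a i"]) auto
  qed
  then obtain a where inj: "inj_on a {..<?m}"
    and a: "\<And>i. i < ?m \<Longrightarrow> a i \<subseteq> ?U \<and> (if b then w \<le> card (a i) else card (a i) \<le> w)"
    and c: "(if b then (\<Inter>i<?m. a i) else (\<Union>i<?m. a i)) = c" by blast
  have "\<forall>i\<in>{..<?m}. \<exists>l. tree_val l (ts ! i) = a i \<and> distinguished (2 * w) l (ts ! i)"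
  proof
    fix i assume "i \<in> {..<?m}"
    then have i: "i < ?m" by simp
    show "\<exists>l. tree_val l (ts ! i) = a i \<and> distinguished (2 * w) l (ts ! i)"
    proof (rule Node.IH)
      show "ts ! i \<in> set ts" "wf_cotree (ts ! i)" using i Node.prems(1) by auto
      show "outdeg (ts ! i) \<le> w"
        using child_outdeg_le[OF i, of b] Node.prems(2) by (rule order_trans)
      have "\<not> is_op b (ts ! i)" using i Node.prems(1) by auto
      then show "is_op False (ts ! i) \<Longrightarrow> w \<le> card (a i)" "is_op True (ts ! i) \<Longrightarrow> card (a i) \<le> w"
        using a[OF i] by (cases b; simp)+
    qed (use a i in blast)
  qed
  from bchoice[OF this] obtain ls where ls: "\<And>i. i < ?m \<Longrightarrow> tree_val (ls i) (ts ! i) = a i"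
    "\<And>i. i < ?m \<Longrightarrow> distinguished (2 * w) (ls i) (ts ! i)" by auto
  \<comment> \<open>Siblings have disjoint leaf sets, so their labellings glue together.\<close>
  define l where "l = (\<lambda>v. ls (child_index ts v) v)"
  have l: "l v = ls i v" if "i < ?m" "v \<in> leaves (ts ! i)" for i v
    using child_index_eq[OF Node.prems(1) that] by (simp add: l_def)
  have val: "tree_val l (ts ! i) = a i" if "i < ?m" for i
    using tree_val_cong[of "ts ! i" l "ls i"] l that ls(1) by blast
  have dist: "distinguished (2 * w) l (ts ! i)" if "i < ?m" for i
    using distinguished_cong[of "ts ! i" l "ls i"] l that ls(2) by blast
  have set_ts: "set ts = (\<lambda>i. ts ! i) ` {..<?m}" by (auto simp: set_conv_nth)
  have "tree_val l (Node b ts) = c"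
    using c val by (cases b) (simp_all add: set_ts image_image)
  moreover have "distinguished (2 * w) l (Node b ts)"
  proof -
    have "a i \<inter> ?U \<noteq> a j \<inter> ?U" if "i < ?m" "j < ?m" "i \<noteq> j" for i j
      using a that inj unfolding inj_on_def by (metis inf.absorb1 lessThan_iff)
    then show ?thesis using dist val by (auto simp: set_ts)
  qed
  ultimately show ?case by blast
qed

section \<open>Lexicographic comparison of bit vectors, and the order of the leaves that it
  induces\<close>

definition set_less :: "nat \<Rightarrow> nat set \<Rightarrow> nat set \<Rightarrow> bool" where
  "set_less n A B \<longleftrightarrow> (\<exists>i<n. i \<in> B \<and> i \<notin> A \<and> (\<forall>j<i. j \<in> A \<longleftrightarrow> j \<in> B))"

lemma set_less_irrefl: "\<not> set_less n A A"
  by (auto simp: set_less_def)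

lemma set_less_trans:
  assumes "set_less n A B" "set_less n B C"
  shows "set_less n A C"
proof -
  from assms obtain i j where "i < n" "i \<in> B" "i \<notin> A" "\<forall>k<i. k \<in> A \<longleftrightarrow> k \<in> B"
    "j < n" "j \<in> C" "j \<notin> B" "\<forall>k<j. k \<in> B \<longleftrightarrow> k \<in> C"
    by (auto simp: set_less_def)
  then show ?thesis
    unfolding set_less_def by (intro exI[of _ "min i j"]) (cases i j rule: linorder_cases; auto)
qed

lemma set_less_total:
  assumes "A \<inter> {..<n} \<noteq> B \<inter> {..<n}"
  shows "set_less n A B \<or> set_less n B A"
proof -
  define i where "i = (LEAST i. i \<in> A \<longleftrightarrow> i \<notin> B)"
  from assms obtain k where k: "k < n" "k \<in> A \<longleftrightarrow> k \<notin> B" by auto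
  have "i \<in> A \<longleftrightarrow> i \<notin> B" unfolding i_def using k(2) by (rule LeastI)
  moreover have "i \<le> k" unfolding i_def using k(2) by (rule Least_le)
  moreover have "\<forall>j<i. j \<in> A \<longleftrightarrow> j \<in> B" unfolding i_def using not_less_Least by blast
  ultimately show ?thesis using k(1) unfolding set_less_def by (meson le_less_trans)
qed

fun tree_ord :: "nat \<Rightarrow> ('v \<Rightarrow> nat set) \<Rightarrow> 'v cotree \<Rightarrow> ('v \<times> 'v) set" where
  "tree_ord n l (Leaf v) = {(v, v)}"
| "tree_ord n l (Node b ts) = (\<Union>t\<in>set ts. tree_ord n l t) \<union>
     {(u, w). \<exists>i<length ts. \<exists>j<length ts. u \<in> leaves (ts ! i) \<and> w \<in> leaves (ts ! j) \<and>
        set_less n (tree_val l (ts ! i)) (tree_val l (ts ! j))}"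

lemma tree_ord_subset: "tree_ord n l t \<subseteq> leaves t \<times> leaves t"
proof (induction t)
  case (Node b ts)
  then show ?case by (fastforce dest: nth_mem)
qed simp

lemma tree_ord_child:
  assumes "wf_cotree (Node b ts)" "i < length ts" "u \<in> leaves (ts ! i)" "w \<in> leaves (ts ! i)"
  shows "(u, w) \<in> tree_ord n l (Node b ts) \<longleftrightarrow> (u, w) \<in> tree_ord n l (ts ! i)"
proof
  assume "(u, w) \<in> tree_ord n l (Node b ts)"
  then consider t where "t \<in> set ts" "(u, w) \<in> tree_ord n l t"
    | j k where "j < length ts" "k < length ts" "u \<in> leaves (ts ! j)" "w \<in> leaves (ts ! k)"
      "set_less n (tree_val l (ts ! j)) (tree_val l (ts ! k))"
    by auto
  then show "(u, w) \<in> tree_ord n l (ts ! i)"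
  proof cases
    case 1
    then obtain j where j: "j < length ts" "t = ts ! j" by (auto simp: in_set_conv_nth)
    then have "u \<in> leaves (ts ! j)" using 1 tree_ord_subset by blast
    then show ?thesis using 1 j child_unique[OF assms(1,2) j(1) assms(3)] by auto
  next
    case 2
    then have "i = j" "i = k"
      using child_unique[OF assms(1,2) 2(1) assms(3)] child_unique[OF assms(1,2) 2(2) assms(4)]
      by auto
    then show ?thesis using 2 set_less_irrefl by blast
  qed
qed (use assms in auto)

lemma tree_ord_cross:
  assumes "wf_cotree (Node b ts)" "i < length ts" "j < length ts" "i \<noteq> j"
    "u \<in> leaves (ts ! i)" "w \<in> leaves (ts ! j)"
  shows "(u, w) \<in> tree_ord n l (Node b ts) \<longleftrightarrow>
    set_less n (tree_val l (ts ! i)) (tree_val l (ts ! j))"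
proof
  assume "(u, w) \<in> tree_ord n l (Node b ts)"
  then consider t where "t \<in> set ts" "(u, w) \<in> tree_ord n l t"
    | j k where "j < length ts" "k < length ts" "u \<in> leaves (ts ! j)" "w \<in> leaves (ts ! k)"
      "set_less n (tree_val l (ts ! j)) (tree_val l (ts ! k))"
    by auto
  then show "set_less n (tree_val l (ts ! i)) (tree_val l (ts ! j))"
  proof cases
    case 1
    then obtain k where k: "k < length ts" "t = ts ! k" by (auto simp: in_set_conv_nth)
    then have "u \<in> leaves (ts ! k)" "w \<in> leaves (ts ! k)" using 1 tree_ord_subset by blast+
    then show ?thesis
      using child_unique[OF assms(1,2) k(1) assms(5)] child_unique[OF assms(1,3) k(1) assms(6)]
        assms(4) by auto
  next
    case (2 j' k')
    then have "i = j'" "j = k'"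
      using child_unique[OF assms(1,2) 2(1) assms(5)] child_unique[OF assms(1,3) 2(2) assms(6)]
      by auto
    then show ?thesis using 2 by blast
  qed
qed (use assms in auto)

text \<open>Two leaves are compared at the node where their branches part; there
  \<open>distinguished\<close> gives different bit vectors, and \<open>set_less\<close> is a strict
  linear order on these.\<close>

lemma linear_order_tree_ord:
  "wf_cotree t \<Longrightarrow> distinguished n l t \<Longrightarrow> linear_order_on (leaves t) (tree_ord n l t)"
proof (induction t)
  case (Leaf v)
  then show ?case
    by (auto simp: linear_order_on_def partial_order_on_def preorder_on_def refl_on_def
        trans_def antisym_def total_on_def)
next
  case (Node b ts)
  let ?r = "tree_ord n l (Node b ts)" and ?L = "leaves (Node b ts)"
  note wf = Node.prems(1)
  have IH: "linear_order_on (leaves (ts ! i)) (tree_ord n l (ts ! i))" if "i < length ts" for i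
    using Node that by simp
  have refl_i: "(u, u) \<in> tree_ord n l (ts ! i)" if "i < length ts" "u \<in> leaves (ts ! i)" for i u
    using IH[OF that(1)] that(2)
    by (auto simp: linear_order_on_def partial_order_on_def preorder_on_def refl_on_def)
  have trans_i: "trans (tree_ord n l (ts ! i))" and anti_i: "antisym (tree_ord n l (ts ! i))"
    and total_i: "total_on (leaves (ts ! i)) (tree_ord n l (ts ! i))" if "i < length ts" for i
    using IH[OF that]
    by (simp_all add: linear_order_on_def partial_order_on_def preorder_on_def)
  have sub: "?r \<subseteq> ?L \<times> ?L" by (rule tree_ord_subset)
  have "refl_on ?L ?r"
  proof (rule refl_onI)
    fix u assume "u \<in> ?L"
    then obtain i where "i < length ts" "u \<in> leaves (ts ! i)" by (rule leaves_NodeE)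
    then show "(u, u) \<in> ?r" using tree_ord_child[OF wf] refl_i by blast
  qed
  moreover have "trans ?r"
  proof (rule transI)
    fix u v w assume uv: "(u, v) \<in> ?r" and vw: "(v, w) \<in> ?r"
    then have "u \<in> ?L" "v \<in> ?L" "w \<in> ?L" using sub by blast+
    then obtain i j k where i: "i < length ts" "u \<in> leaves (ts ! i)"
      and j: "j < length ts" "v \<in> leaves (ts ! j)" and k: "k < length ts" "w \<in> leaves (ts ! k)"
      by (meson leaves_NodeE)
    have uv': "if i = j then (u, v) \<in> tree_ord n l (ts ! i)
        else set_less n (tree_val l (ts ! i)) (tree_val l (ts ! j))"
      using uv tree_ord_child[OF wf] tree_ord_cross[OF wf] i j by metis
    have vw': "if j = k then (v, w) \<in> tree_ord n l (ts ! j)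
        else set_less n (tree_val l (ts ! j)) (tree_val l (ts ! k))"
      using vw tree_ord_child[OF wf] tree_ord_cross[OF wf] k j by metis
    show "(u, w) \<in> ?r"
    proof (cases "i = k")
      \<comment> \<open>If \<open>v\<close> lay in another child than \<open>u\<close> and
        \<open>w\<close>, the values of the two children would be strictly smaller than each
        other.\<close>
      case True
      then have "j = i"
        using uv' vw' set_less_trans set_less_irrefl by (metis (full_types))
      then show ?thesis
        using True uv' vw' trans_i[OF i(1)] tree_ord_child[OF wf i(1)] i k
        by (metis (full_types) transD)
    next
      case False
      then have "set_less n (tree_val l (ts ! i)) (tree_val l (ts ! k))"
        using uv' vw' set_less_trans by (metis (full_types))
      then show ?thesis using tree_ord_cross[OF wf i(1) k(1) False i(2) k(2)] by blast
    qed
  qed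
  moreover have "antisym ?r"
  proof (rule antisymI)
    fix u v assume uv: "(u, v) \<in> ?r" and vu: "(v, u) \<in> ?r"
    then have "u \<in> ?L" "v \<in> ?L" using sub by blast+
    then obtain i j where i: "i < length ts" "u \<in> leaves (ts ! i)"
      and j: "j < length ts" "v \<in> leaves (ts ! j)"
      by (meson leaves_NodeE)
    have "i = j"
    proof (rule ccontr)
      assume "i \<noteq> j"
      then show False
        using uv vu tree_ord_cross[OF wf i(1) j(1) _ i(2) j(2)]
          tree_ord_cross[OF wf j(1) i(1) _ j(2) i(2)] set_less_trans set_less_irrefl by blast
    qed
    then show "u = v"
      using uv vu tree_ord_child[OF wf i(1)] i(2) j(2) anti_i[OF i(1)] by (blast dest: antisymD)
  qed
  moreover have "total_on ?L ?r"
  proof (rule total_onI)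
    fix u v assume "u \<in> ?L" "v \<in> ?L" and ne: "u \<noteq> v"
    then obtain i j where i: "i < length ts" "u \<in> leaves (ts ! i)"
      and j: "j < length ts" "v \<in> leaves (ts ! j)"
      by (meson leaves_NodeE)
    show "(u, v) \<in> ?r \<or> (v, u) \<in> ?r"
    proof (cases "i = j")
      case True
      then show ?thesis
        using total_i[OF i(1)] ne i j tree_ord_child[OF wf i(1)] by (auto simp: total_on_def)
    next
      case False
      then have "tree_val l (ts ! i) \<inter> {..<n} \<noteq> tree_val l (ts ! j) \<inter> {..<n}"
        using Node.prems(2) i j by simp
      from set_less_total[OF this] show ?thesis
        using tree_ord_cross[OF wf i(1) j(1) _ i(2) j(2)]
          tree_ord_cross[OF wf j(1) i(1) _ j(2) i(2)] False by blast
    qed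
  qed
  ultimately show ?case
    using sub by (simp add: linear_order_on_def partial_order_on_def preorder_on_def)
qed

section \<open>Defining the order\<close>

text \<open>For irreflexive \<open>E\<close>, this is a maximal clique of the graph induced on
  \<open>U\<close> that lies in \<open>S\<close>. A member of \<open>K\<close> is its own
  non-neighbour, so the last conjunct only restricts vertices outside \<open>K\<close>; it also
  forces \<open>K\<close> to be nonempty when \<open>U\<close> is.\<close>

definition has_clique :: "('v \<times> 'v) set \<Rightarrow> 'v set \<Rightarrow> 'v set \<Rightarrow> bool" where
  "has_clique E S U \<longleftrightarrow> (\<exists>K\<subseteq>U \<inter> S. (\<forall>z\<in>K. \<forall>z'\<in>K. z = z' \<or> (z, z') \<in> E) \<and>
     (\<forall>z\<in>U. \<exists>z'\<in>K. (z, z') \<notin> E))"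

lemma has_clique_cong:
  assumes "\<And>u w. u \<in> U \<Longrightarrow> w \<in> U \<Longrightarrow> (u, w) \<in> E \<longleftrightarrow> (u, w) \<in> E'"
  shows "has_clique E S U \<longleftrightarrow> has_clique E' S U"
proof -
  have "has_clique E' S U"
    if E: "\<And>u w. u \<in> U \<Longrightarrow> w \<in> U \<Longrightarrow> (u, w) \<in> E \<longleftrightarrow> (u, w) \<in> E'" and "has_clique E S U"
    for E E' :: "('a \<times> 'a) set"
  proof -
    obtain K where K: "K \<subseteq> U \<inter> S" "\<forall>z\<in>K. \<forall>z'\<in>K. z = z' \<or> (z, z') \<in> E"
      "\<forall>z\<in>U. \<exists>z'\<in>K. (z, z') \<notin> E"
      using \<open>has_clique E S U\<close> by (auto simp: has_clique_def)
    have "K \<subseteq> U" using K(1) by blast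
    then have "\<forall>z\<in>K. \<forall>z'\<in>K. z = z' \<or> (z, z') \<in> E'" "\<forall>z\<in>U. \<exists>z'\<in>K. (z, z') \<notin> E'"
      using K(2,3) E by blast+
    then show ?thesis using K(1) unfolding has_clique_def by blast
  qed
  from this[of E E'] this[of E' E] show ?thesis using assms by blast
qed

text \<open>Maximal cliques of a join combine maximal cliques of all its parts, those of a disjoint
  union are maximal cliques of one part, so asking for one inside a given set evaluates the
  cotree as an and-or tree.\<close>

lemma has_clique_tree_val:
  "wf_cotree t \<Longrightarrow> has_clique (cotree_edges t) {v. i \<in> l v} (leaves t) \<longleftrightarrow> i \<in> tree_val l t"
proof (induction t)
  case (Leaf v)
  then show ?case by (auto simp: has_clique_def)
next
  case (Node b ts)
  note wf = Node.prems
  let ?E = "cotree_edges (Node b ts)" and ?S = "{v. i \<in> l v}" and ?L = "leaves (Node b ts)"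
  have child: "has_clique ?E ?S (leaves (ts ! j)) \<longleftrightarrow> i \<in> tree_val l (ts ! j)"
    if "j < length ts" for j
  proof -
    have "has_clique ?E ?S (leaves (ts ! j)) \<longleftrightarrow>
        has_clique (cotree_edges (ts ! j)) ?S (leaves (ts ! j))"
      using cotree_edges_child[OF wf that] by (rule has_clique_cong)
    then show ?thesis using Node that by simp
  qed
  have sub: "leaves (ts ! j) \<subseteq> ?L" if "j < length ts" for j
    using that by (rule leaves_nth_subset)
  have ne: "leaves (ts ! j) \<noteq> {}" if "j < length ts" for j
    using leaves_nonempty[OF wf_cotree_child[OF wf that]] .
  show ?case
  proof (cases b)
    case False
    have cross: "(u, w) \<notin> ?E" if "j < length ts" "u \<in> leaves (ts ! j)" "w \<in> ?L"
      "w \<notin> leaves (ts ! j)" for j u w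
    proof -
      obtain k where "k < length ts" "w \<in> leaves (ts ! k)"
        using \<open>w \<in> ?L\<close> by (rule leaves_NodeE)
      moreover then have "j \<noteq> k" using that by auto
      ultimately show ?thesis using cotree_edges_cross[OF wf that(1)] that(2) False by blast
    qed
    have "has_clique ?E ?S ?L \<longleftrightarrow> (\<exists>j<length ts. has_clique ?E ?S (leaves (ts ! j)))"
    proof
      assume "has_clique ?E ?S ?L"
      then obtain K where K: "K \<subseteq> ?L \<inter> ?S" "\<forall>z\<in>K. \<forall>z'\<in>K. z = z' \<or> (z, z') \<in> ?E"
        "\<forall>z\<in>?L. \<exists>z'\<in>K. (z, z') \<notin> ?E" unfolding has_clique_def by blast
      have "?L \<noteq> {}" using leaves_nonempty[OF wf] .
      then obtain k where k: "k \<in> K" "k \<in> ?L" using K(1,3) by blast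
      obtain j where j: "j < length ts" "k \<in> leaves (ts ! j)" using k(2) by (rule leaves_NodeE)
      \<comment> \<open>Vertices from different children of a disjoint union are not adjacent, so a
        clique meets one child only.\<close>
      have "K \<subseteq> leaves (ts ! j)"
      proof
        fix z assume z: "z \<in> K"
        show "z \<in> leaves (ts ! j)"
        proof (rule ccontr)
          assume "z \<notin> leaves (ts ! j)"
          moreover have "z \<in> ?L" using K(1) z by blast
          ultimately have "(k, z) \<notin> ?E" using cross[OF j] by blast
          then have "k = z" using K(2) k(1) z by blast
          then show False using j(2) \<open>z \<notin> leaves (ts ! j)\<close> by blast
        qed
      qed
      then have "K \<subseteq> leaves (ts ! j) \<inter> ?S" using K(1) by blast
      moreover have "\<forall>z\<in>leaves (ts ! j). \<exists>z'\<in>K. (z, z') \<notin> ?E" using K(3) sub[OF j(1)] by blast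
      ultimately show "\<exists>j<length ts. has_clique ?E ?S (leaves (ts ! j))"
        using K(2) j(1) unfolding has_clique_def by blast
    next
      assume "\<exists>j<length ts. has_clique ?E ?S (leaves (ts ! j))"
      then obtain j K where j: "j < length ts" and K: "K \<subseteq> leaves (ts ! j) \<inter> ?S"
        "\<forall>z\<in>K. \<forall>z'\<in>K. z = z' \<or> (z, z') \<in> ?E" "\<forall>z\<in>leaves (ts ! j). \<exists>z'\<in>K. (z, z') \<notin> ?E"
        unfolding has_clique_def by blast
      obtain k where k: "k \<in> K" using K(3) ne[OF j] by blast
      have "\<exists>z'\<in>K. (z, z') \<notin> ?E" if z: "z \<in> ?L" for z
      proof (cases "z \<in> leaves (ts ! j)")
        case True
        then show ?thesis using K(3) by blast
      next
        case False
        \<comment> \<open>Any fixed member of the clique witnesses maximality against all vertices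
          of the other children.\<close>
        then have "(k, z) \<notin> ?E" using cross[OF j _ z] k K(1) by blast
        then have "(z, k) \<notin> ?E" using sym_cotree_edges by (metis symD)
        then show ?thesis using k by blast
      qed
      moreover have "K \<subseteq> ?L \<inter> ?S" using K(1) sub[OF j] by blast
      ultimately show "has_clique ?E ?S ?L" using K(2) unfolding has_clique_def by blast
    qed
    also have "\<dots> \<longleftrightarrow> (\<exists>j<length ts. i \<in> tree_val l (ts ! j))" using child by blast
    also have "\<dots> \<longleftrightarrow> i \<in> tree_val l (Node b ts)"
      using False by (auto simp: set_conv_nth)
    finally show ?thesis .
  next
    case True
    have cross: "(u, w) \<in> ?E" if "j < length ts" "u \<in> leaves (ts ! j)" "w \<in> ?L"
      "w \<notin> leaves (ts ! j)" for j u w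
    proof -
      obtain k where "k < length ts" "w \<in> leaves (ts ! k)"
        using \<open>w \<in> ?L\<close> by (rule leaves_NodeE)
      moreover then have "j \<noteq> k" using that by auto
      ultimately show ?thesis using cotree_edges_cross[OF wf that(1)] that(2) True by blast
    qed
    have "has_clique ?E ?S ?L \<longleftrightarrow> (\<forall>j<length ts. has_clique ?E ?S (leaves (ts ! j)))"
    proof
      assume "has_clique ?E ?S ?L"
      then obtain K where K: "K \<subseteq> ?L \<inter> ?S" "\<forall>z\<in>K. \<forall>z'\<in>K. z = z' \<or> (z, z') \<in> ?E"
        "\<forall>z\<in>?L. \<exists>z'\<in>K. (z, z') \<notin> ?E" unfolding has_clique_def by blast
      show "\<forall>j<length ts. has_clique ?E ?S (leaves (ts ! j))"
      proof (intro allI impI)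
        fix j assume j: "j < length ts"
        let ?K = "K \<inter> leaves (ts ! j)"
        \<comment> \<open>In a join, a non-neighbour of \<open>z\<close> must lie in the same child
          as \<open>z\<close>, so maximality passes to the trace of \<open>K\<close> on that
          child.\<close>
        have "\<forall>z\<in>leaves (ts ! j). \<exists>z'\<in>?K. (z, z') \<notin> ?E"
          using K(1,3) cross[OF j] sub[OF j] by blast
        moreover have "?K \<subseteq> leaves (ts ! j) \<inter> ?S" using K(1) by blast
        moreover have "\<forall>z\<in>?K. \<forall>z'\<in>?K. z = z' \<or> (z, z') \<in> ?E" using K(2) by blast
        ultimately show "has_clique ?E ?S (leaves (ts ! j))" unfolding has_clique_def by blast
      qed
    next
      assume "\<forall>j<length ts. has_clique ?E ?S (leaves (ts ! j))"
      then have "\<forall>j\<in>{..<length ts}. \<exists>K. K \<subseteq> leaves (ts ! j) \<inter> ?S \<and>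
        (\<forall>z\<in>K. \<forall>z'\<in>K. z = z' \<or> (z, z') \<in> ?E) \<and> (\<forall>z\<in>leaves (ts ! j). \<exists>z'\<in>K. (z, z') \<notin> ?E)"
        unfolding has_clique_def by blast
      from bchoice[OF this] obtain K where "\<forall>j\<in>{..<length ts}. K j \<subseteq> leaves (ts ! j) \<inter> ?S \<and>
        (\<forall>z\<in>K j. \<forall>z'\<in>K j. z = z' \<or> (z, z') \<in> ?E) \<and>
        (\<forall>z\<in>leaves (ts ! j). \<exists>z'\<in>K j. (z, z') \<notin> ?E)" ..
      then have K: "K j \<subseteq> leaves (ts ! j) \<inter> ?S" "\<forall>z\<in>K j. \<forall>z'\<in>K j. z = z' \<or> (z, z') \<in> ?E"
        "\<forall>z\<in>leaves (ts ! j). \<exists>z'\<in>K j. (z, z') \<notin> ?E" if "j < length ts" for j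
        using that by simp_all
      let ?K = "\<Union>j<length ts. K j"
      have "?K \<subseteq> ?L \<inter> ?S" using K(1) sub by blast
      moreover have "\<forall>z\<in>?K. \<forall>z'\<in>?K. z = z' \<or> (z, z') \<in> ?E"
      proof (intro ballI)
        fix z z' assume "z \<in> ?K" "z' \<in> ?K"
        then obtain j k where j: "j < length ts" "z \<in> K j" and k: "k < length ts" "z' \<in> K k"
          by blast
        show "z = z' \<or> (z, z') \<in> ?E"
        proof (cases "j = k")
          case True
          then show ?thesis using K(2)[OF j(1)] j k by blast
        next
          case False
          then show ?thesis
            using cotree_edges_cross[OF wf j(1) k(1) False] K(1)[OF j(1)] K(1)[OF k(1)] j k \<open>b\<close>
            by blast
        qed
      qed
      moreover have "\<forall>z\<in>?L. \<exists>z'\<in>?K. (z, z') \<notin> ?E"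
      proof
        fix z assume "z \<in> ?L"
        obtain j where "j < length ts" "z \<in> leaves (ts ! j)"
          using \<open>z \<in> ?L\<close> by (rule leaves_NodeE)
        then show "\<exists>z'\<in>?K. (z, z') \<notin> ?E" using K(3) by blast
      qed
      ultimately show "has_clique ?E ?S ?L"
        unfolding has_clique_def by (intro exI[of _ ?K]) simp
    qed
    also have "\<dots> \<longleftrightarrow> (\<forall>j<length ts. i \<in> tree_val l (ts ! j))" using child by blast
    also have "\<dots> \<longleftrightarrow> i \<in> tree_val l (Node b ts)"
      using True by (auto simp: set_conv_nth)
    finally show ?thesis .
  qed
qed

text \<open>The child containing \<open>x\<close> of the lowest common ancestor of \<open>x\<close> and \<open>y\<close>: inside that child, any
  two vertices are at distance at most 2 in the graph or in its complement, and \<open>y\<close> separates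
  the child from all other vertices.\<close>

definition side :: "'v set \<Rightarrow> ('v \<times> 'v) set \<Rightarrow> 'v \<Rightarrow> 'v \<Rightarrow> 'v set" where
  "side V E x y =
     (if (x, y) \<in> E
      then {z \<in> V. \<exists>a\<in>V. (a, x) \<notin> E \<and> (a, y) \<in> E \<and> (z, a) \<notin> E \<and> (z, y) \<in> E}
      else {z \<in> V. \<exists>a\<in>V. (a = x \<or> (a, x) \<in> E) \<and> (a, y) \<notin> E \<and> (z = a \<or> (z, a) \<in> E) \<and> (z, y) \<notin> E})"

text \<open>A module (homogeneous set) inducing the graph of \<open>t\<close>: vertices outside
  cannot tell its members apart. This invariant replaces the context of a subtree when descending
  from the root to the lowest common ancestor.\<close>

definition is_module :: "'v set \<Rightarrow> ('v \<times> 'v) set \<Rightarrow> 'v cotree \<Rightarrow> bool" where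
  "is_module V E t \<longleftrightarrow> leaves t \<subseteq> V \<and>
     (\<forall>u\<in>leaves t. \<forall>w\<in>leaves t. (u, w) \<in> E \<longleftrightarrow> (u, w) \<in> cotree_edges t) \<and>
     (\<forall>z\<in>V - leaves t. \<forall>u\<in>leaves t. \<forall>w\<in>leaves t. (z, u) \<in> E \<longleftrightarrow> (z, w) \<in> E)"

lemma is_module_cross:
  assumes "wf_cotree (Node b ts)" "is_module V E (Node b ts)"
    "i < length ts" "j < length ts" "i \<noteq> j" "u \<in> leaves (ts ! i)" "w \<in> leaves (ts ! j)"
  shows "(u, w) \<in> E \<longleftrightarrow> b"
proof -
  have "u \<in> leaves (Node b ts)" "w \<in> leaves (Node b ts)"
    using leaves_nth_subset assms(3,4,6,7) by blast+
  then have "(u, w) \<in> E \<longleftrightarrow> (u, w) \<in> cotree_edges (Node b ts)"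
    using assms(2) unfolding is_module_def by blast
  then show ?thesis using cotree_edges_cross[OF assms(1,3-7)] by blast
qed

lemma is_module_child:
  assumes "wf_cotree (Node b ts)" "is_module V E (Node b ts)" "i < length ts"
  shows "is_module V E (ts ! i)"
  unfolding is_module_def
proof (intro conjI ballI)
  let ?L = "leaves (Node b ts)"
  have sub: "leaves (ts ! i) \<subseteq> ?L" by (rule leaves_nth_subset[OF assms(3)])
  then show "leaves (ts ! i) \<subseteq> V" using assms(2) unfolding is_module_def by blast
  fix u w assume u: "u \<in> leaves (ts ! i)" and w: "w \<in> leaves (ts ! i)"
  then show "(u, w) \<in> E \<longleftrightarrow> (u, w) \<in> cotree_edges (ts ! i)"
    using assms(2) sub cotree_edges_child[OF assms(1,3) u w] unfolding is_module_def by blast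
  fix z assume z: "z \<in> V - leaves (ts ! i)"
  show "(z, u) \<in> E \<longleftrightarrow> (z, w) \<in> E"
  proof (cases "z \<in> ?L")
    case True
    then obtain j where j: "j < length ts" "z \<in> leaves (ts ! j)" by (rule leaves_NodeE)
    then have "j \<noteq> i" using z by auto
    then show ?thesis using is_module_cross[OF assms(1,2) j(1) assms(3) _ j(2)] u w by blast
  next
    case False
    then show ?thesis using assms(2) z u w sub unfolding is_module_def by blast
  qed
qed

text \<open>Here \<open>b\<close> is the label of the parent, so an inner node \<open>t\<close> has
  the opposite label: leaves of different children are related directly, and leaves of the same
  child through any leaf of another child, which exists because a node has at least two
  children.\<close>

lemma distance_two:
  assumes "wf_cotree t" "\<not> is_op b t" "x \<in> leaves t" "z \<in> leaves t"
  obtains a where "a \<in> leaves t" "a = x \<or> ((a, x) \<in> cotree_edges t \<longleftrightarrow> \<not> b)"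
    "z = a \<or> ((z, a) \<in> cotree_edges t \<longleftrightarrow> \<not> b)"
proof (cases t)
  case (Leaf v)
  then show ?thesis using assms that by auto
next
  case (Node c ts)
  note wf = assms(1)[unfolded Node]
  have c: "c \<longleftrightarrow> \<not> b" using assms(2) Node by auto
  obtain p q where p: "p < length ts" "x \<in> leaves (ts ! p)"
    and q: "q < length ts" "z \<in> leaves (ts ! q)"
    using assms(3,4) unfolding Node by (meson leaves_NodeE)
  show ?thesis
  proof (cases "p = q")
    case False
    then have "(z, x) \<in> cotree_edges t \<longleftrightarrow> \<not> b"
      using cotree_edges_cross[OF wf q(1) p(1) _ q(2) p(2)] c Node by blast
    then show ?thesis using that assms(3) by blast
  next
    case True
    have "2 \<le> length ts" using wf by simp
    then obtain r where r: "r < length ts" "r \<noteq> p"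
      by (metis One_nat_def Suc_le_lessD le_less_trans less_numeral_extra(3) numeral_2_eq_2
          zero_le zero_less_one)
    obtain a where a: "a \<in> leaves (ts ! r)"
      using leaves_nonempty[OF wf_cotree_child[OF wf r(1)]] by blast
    have "(a, x) \<in> cotree_edges t \<longleftrightarrow> \<not> b" "(z, a) \<in> cotree_edges t \<longleftrightarrow> \<not> b"
      using cotree_edges_cross[OF wf r(1) p(1) r(2) a p(2)]
        cotree_edges_cross[OF wf q(1) r(1) _ q(2) a] r(2) True c Node by auto
    moreover have "a \<in> leaves t" using leaves_nth_subset[OF r(1), of c] a Node by blast
    ultimately show ?thesis using that by blast
  qed
qed

text \<open>The relation opposite to \<open>b\<close> cannot leave the child as long as the vertices
  stay related to \<open>y\<close> as the child is (\<open>closed\<close>), and two steps of it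
  reach the whole child (\<open>reach\<close>).\<close>

lemma side_eq:
  assumes "sym E" and wf: "wf_cotree (Node b ts)" and md: "is_module V E (Node b ts)"
    and i: "i < length ts" and j: "j < length ts" and ij: "i \<noteq> j"
    and x: "x \<in> leaves (ts ! i)" and y: "y \<in> leaves (ts ! j)"
  shows "side V E x y = leaves (ts ! i)"
proof -
  let ?L = "leaves (Node b ts)" and ?u = "leaves (ts ! i)"
  have subL: "?u \<subseteq> ?L" "leaves (ts ! j) \<subseteq> ?L"
    using leaves_nth_subset[OF i] leaves_nth_subset[OF j] by blast+
  have subV: "?L \<subseteq> V" using md by (simp add: is_module_def)
  have cross: "(u, w) \<in> E \<longleftrightarrow> b" if "k < length ts" "k \<noteq> i" "u \<in> leaves (ts ! k)" "w \<in> ?u" for u w k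
    using is_module_cross[OF wf md that(1) i that(2,3,4)] .
  have uy: "(u, y) \<in> E \<longleftrightarrow> b" if "u \<in> ?u" for u
    using is_module_cross[OF wf md i j ij that y] .
  \<comment> \<open>A vertex of a sibling is related to \<open>w\<close> by \<open>b\<close>. A
    vertex outside the whole node does not distinguish \<open>w\<close> from \<open>y\<close>, so it
    too would be related to \<open>w\<close> by \<open>b\<close>.\<close>
  have closed: "z \<in> ?u" if z: "z \<in> V" "w \<in> ?u" "z = w \<or> ((z, w) \<in> E \<longleftrightarrow> \<not> b)" "(z, y) \<in> E \<longleftrightarrow> b"
    for z w
  proof (rule ccontr)
    assume nz: "z \<notin> ?u"
    then have ne: "(z, w) \<in> E \<longleftrightarrow> \<not> b" using z by auto
    show False
    proof (cases "z \<in> ?L")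
      case True
      then obtain k where k: "k < length ts" "z \<in> leaves (ts ! k)" by (rule leaves_NodeE)
      then have "k \<noteq> i" using nz by auto
      then show False using cross[OF k(1) _ k(2) z(2)] ne by auto
    next
      case False
      then have "(z, w) \<in> E \<longleftrightarrow> (z, y) \<in> E"
        using md z(1,2) y subL unfolding is_module_def by blast
      then show False using ne z(4) by auto
    qed
  qed
  have wfi: "wf_cotree (ts ! i)" "\<not> is_op b (ts ! i)" using wf i by auto
  have E_i: "(u, w) \<in> E \<longleftrightarrow> (u, w) \<in> cotree_edges (ts ! i)" if "u \<in> ?u" "w \<in> ?u" for u w
    using is_module_child[OF wf md i] that unfolding is_module_def by blast
  \<comment> \<open>Without loops, non-adjacency includes equality; this is why only the
    non-adjacent case of \<open>side\<close> lists equalities explicitly.\<close>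
  have irr: "(u, u) \<notin> E" if "u \<in> ?u" for u
    using E_i irrefl_cotree_edges[OF wfi(1)] that by blast
  have reach: "\<exists>a\<in>?u. (a = x \<or> ((a, x) \<in> E \<longleftrightarrow> \<not> b)) \<and> (z = a \<or> ((z, a) \<in> E \<longleftrightarrow> \<not> b))"
    if z: "z \<in> ?u" for z
    using distance_two[OF wfi x z] E_i x z by metis
  show ?thesis
  proof (cases b)
    case True
    then have "side V E x y =
        {z \<in> V. \<exists>a\<in>V. (a, x) \<notin> E \<and> (a, y) \<in> E \<and> (z, a) \<notin> E \<and> (z, y) \<in> E}"
      using uy[OF x] by (simp add: side_def)
    also have "\<dots> = ?u"
    proof (intro equalityI subsetI)
      fix z assume "z \<in> {z \<in> V. \<exists>a\<in>V. (a, x) \<notin> E \<and> (a, y) \<in> E \<and> (z, a) \<notin> E \<and> (z, y) \<in> E}"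
      then obtain a where "z \<in> V" "a \<in> V" "(a, x) \<notin> E" "(a, y) \<in> E" "(z, a) \<notin> E" "(z, y) \<in> E"
        by blast
      moreover then have "a \<in> ?u" using closed[of a x] x True by blast
      ultimately show "z \<in> ?u" using closed[of z a] True by blast
    next
      fix z assume z: "z \<in> ?u"
      obtain a where "a \<in> ?u" "a = x \<or> (a, x) \<notin> E" "z = a \<or> (z, a) \<notin> E"
        using reach[OF z] True by blast
      moreover then have "(a, x) \<notin> E" "(z, a) \<notin> E" using irr by blast+
      ultimately show "z \<in> {z \<in> V. \<exists>a\<in>V. (a, x) \<notin> E \<and> (a, y) \<in> E \<and> (z, a) \<notin> E \<and> (z, y) \<in> E}"
        using uy z True subL subV by blast
    qed
    finally show ?thesis .
  next
    case False
    then have "side V E x y = {z \<in> V. \<exists>a\<in>V. (a = x \<or> (a, x) \<in> E) \<and> (a, y) \<notin> E \<and>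
        (z = a \<or> (z, a) \<in> E) \<and> (z, y) \<notin> E}"
      using uy[OF x] by (simp add: side_def)
    also have "\<dots> = ?u"
    proof (intro equalityI subsetI)
      fix z assume "z \<in> {z \<in> V. \<exists>a\<in>V. (a = x \<or> (a, x) \<in> E) \<and> (a, y) \<notin> E \<and>
        (z = a \<or> (z, a) \<in> E) \<and> (z, y) \<notin> E}"
      then obtain a where "z \<in> V" "a \<in> V" "a = x \<or> (a, x) \<in> E" "(a, y) \<notin> E"
        "z = a \<or> (z, a) \<in> E" "(z, y) \<notin> E"
        by blast
      moreover then have "a \<in> ?u" using closed[of a x] x False by blast
      ultimately show "z \<in> ?u" using closed[of z a] False by blast
    next
      fix z assume z: "z \<in> ?u"
      obtain a where "a \<in> ?u" "a = x \<or> (a, x) \<in> E" "z = a \<or> (z, a) \<in> E"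
        using reach[OF z] False by blast
      then show "z \<in> {z \<in> V. \<exists>a\<in>V. (a = x \<or> (a, x) \<in> E) \<and> (a, y) \<notin> E \<and>
        (z = a \<or> (z, a) \<in> E) \<and> (z, y) \<notin> E}"
        using uy z False subL subV by blast
    qed
    finally show ?thesis .
  qed
qed

definition bits :: "'v set \<Rightarrow> ('v \<times> 'v) set \<Rightarrow> ('v \<Rightarrow> nat set) \<Rightarrow> 'v \<Rightarrow> 'v \<Rightarrow> nat set" where
  "bits V E l x y = {i. has_clique E {v. i \<in> l v} (side V E x y)}"

lemma bits_eq:
  assumes "sym E" "wf_cotree (Node b ts)" "is_module V E (Node b ts)"
    "i < length ts" "j < length ts" "i \<noteq> j" "x \<in> leaves (ts ! i)" "y \<in> leaves (ts ! j)"
  shows "bits V E l x y = tree_val l (ts ! i)"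
proof -
  have "has_clique E S (leaves (ts ! i)) \<longleftrightarrow> has_clique (cotree_edges (ts ! i)) S (leaves (ts ! i))"
    for S
    by (rule has_clique_cong) (use is_module_child[OF assms(2-4)] in \<open>auto simp: is_module_def\<close>)
  then show ?thesis
    unfolding bits_def side_eq[OF assms]
      has_clique_tree_val[OF wf_cotree_child[OF assms(2,4)], symmetric]
    using has_clique_tree_val[OF wf_cotree_child[OF assms(2,4)]] by simp
qed

text \<open>Since \<open>bits\<close> refers to the whole graph and not to \<open>t\<close>, its
  right-hand side stays unchanged when the induction moves to the child containing both vertices;
  where the vertices part, \<open>bits\<close> returns the values of the two children.\<close>

lemma tree_ord_eq_bits:
  assumes "sym E"
  shows "wf_cotree t \<Longrightarrow> is_module V E t \<Longrightarrow> x \<in> leaves t \<Longrightarrow> y \<in> leaves t \<Longrightarrow>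
    (x, y) \<in> tree_ord n l t \<longleftrightarrow> x = y \<or> set_less n (bits V E l x y) (bits V E l y x)"
proof (induction t)
  case (Node b ts)
  note wf = Node.prems(1) and md = Node.prems(2)
  obtain i j where i: "i < length ts" "x \<in> leaves (ts ! i)"
    and j: "j < length ts" "y \<in> leaves (ts ! j)"
    using Node.prems(3,4) by (meson leaves_NodeE)
  show ?case
  proof (cases "i = j")
    case True
    have y: "y \<in> leaves (ts ! i)" using True j by simp
    have "(x, y) \<in> tree_ord n l (ts ! i) \<longleftrightarrow> x = y \<or> set_less n (bits V E l x y) (bits V E l y x)"
      using i y wf by (intro Node.IH is_module_child[OF wf md]) auto
    then show ?thesis using tree_ord_child[OF wf i y] by blast
  next
    case False
    then have "x \<noteq> y" using child_unique[OF wf i(1) j(1) i(2)] j(2) by blast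
    moreover have "j \<noteq> i" using False by simp
    ultimately show ?thesis
      using tree_ord_cross[OF wf i(1) j(1) False i(2) j(2)]
        bits_eq[OF assms wf md i(1) j(1) False i(2) j(2)]
        bits_eq[OF assms wf md j(1) i(1) \<open>j \<noteq> i\<close> j(2) i(2)] by simp
  qed
qed simp

section \<open>The order as a formula\<close>

definition Or :: "mso \<Rightarrow> mso \<Rightarrow> mso" where "Or \<phi> \<psi> = Neg (Conj (Neg \<phi>) (Neg \<psi>))"
definition Imp :: "mso \<Rightarrow> mso \<Rightarrow> mso" where "Imp \<phi> \<psi> = Neg (Conj \<phi> (Neg \<psi>))"
definition AllF :: "nat \<Rightarrow> mso \<Rightarrow> mso" where "AllF x \<phi> = Neg (ExF x (Neg \<phi>))"
definition Iff :: "mso \<Rightarrow> mso \<Rightarrow> mso" where "Iff \<phi> \<psi> = Conj (Imp \<phi> \<psi>) (Imp \<psi> \<phi>)"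

fun Disjs :: "(nat \<Rightarrow> mso) \<Rightarrow> nat \<Rightarrow> mso" where
  "Disjs \<phi> 0 = Neg (Eqv 0 0)"
| "Disjs \<phi> (Suc n) = Or (Disjs \<phi> n) (\<phi> n)"

lemma sat_Or: "sat G fo so (Or \<phi> \<psi>) \<longleftrightarrow> sat G fo so \<phi> \<or> sat G fo so \<psi>"
  by (simp add: Or_def)

lemma sat_Imp: "sat G fo so (Imp \<phi> \<psi>) \<longleftrightarrow> (sat G fo so \<phi> \<longrightarrow> sat G fo so \<psi>)"
  by (simp add: Imp_def)

lemma sat_Iff: "sat G fo so (Iff \<phi> \<psi>) \<longleftrightarrow> (sat G fo so \<phi> \<longleftrightarrow> sat G fo so \<psi>)"
  by (auto simp: Iff_def sat_Imp)

lemma sat_AllF: "sat G fo so (AllF x \<phi>) \<longleftrightarrow> (\<forall>a\<in>verts G. sat G (fo(x := a)) so \<phi>)"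
  by (simp add: AllF_def)

lemma sat_Disjs: "sat G fo so (Disjs \<phi> n) \<longleftrightarrow> (\<exists>i<n. sat G fo so (\<phi> i))"
  by (induction n) (auto simp: sat_Or less_Suc_eq)

text \<open>First-order variables 0 and 1 are the two vertices to be compared, 2 is the vertex tested for
  membership in a side; the set variable \<open>n\<close>, the first one that is not a parameter, is the
  clique.\<close>

definition side_fm :: "nat \<Rightarrow> nat \<Rightarrow> mso" where
  "side_fm p q =
     Or (Conj (Adj p q) (ExF 3 (Conj (Conj (Neg (Adj 3 p)) (Adj 3 q))
                                     (Conj (Neg (Adj 2 3)) (Adj 2 q)))))
        (Conj (Neg (Adj p q)) (ExF 3 (Conj (Conj (Or (Eqv 3 p) (Adj 3 p)) (Neg (Adj 3 q)))
                                           (Conj (Or (Eqv 2 3) (Adj 2 3)) (Neg (Adj 2 q))))))"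

lemma sat_side_fm:
  assumes "p < 2" "q < 2" "fo 2 \<in> verts G"
  shows "sat G fo so (side_fm p q) \<longleftrightarrow> fo 2 \<in> side (verts G) (edges G) (fo p) (fo q)"
  using assms by (simp add: side_fm_def side_def sat_Or)

text \<open>The formula follows the shape of \<open>has_clique\<close>. Variable 3 is bound inside
  \<open>side_fm\<close>, so the second vertex of a pair is variable 4.\<close>

definition bit_fm :: "nat \<Rightarrow> nat \<Rightarrow> nat \<Rightarrow> nat \<Rightarrow> mso" where
  "bit_fm n p q i = ExS n (Conj (AllF 2 (Imp (Mem 2 n) (Conj (Mem 2 i) (side_fm p q))))
     (Conj (AllF 2 (AllF 4 (Imp (Conj (Mem 2 n) (Mem 4 n)) (Or (Eqv 2 4) (Adj 2 4)))))
           (AllF 2 (Imp (side_fm p q) (ExF 4 (Conj (Mem 4 n) (Neg (Adj 2 4))))))))"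

lemma sat_bit_fm:
  assumes "p < 2" "q < 2" "i < n"
  shows "sat G fo so (bit_fm n p q i) \<longleftrightarrow>
    has_clique (edges G) (so i) (side (verts G) (edges G) (fo p) (fo q))"
proof -
  let ?V = "verts G" and ?E = "edges G" and ?U = "side (verts G) (edges G) (fo p) (fo q)"
  have U: "?U \<subseteq> ?V" by (auto simp: side_def)
  have "sat G fo so (bit_fm n p q i) \<longleftrightarrow> (\<exists>K\<subseteq>?V. (\<forall>z\<in>?V. z \<in> K \<longrightarrow> z \<in> so i \<and> z \<in> ?U) \<and>
      (\<forall>z\<in>?V. \<forall>z'\<in>?V. z \<in> K \<and> z' \<in> K \<longrightarrow> z = z' \<or> (z, z') \<in> ?E) \<and>
      (\<forall>z\<in>?V. z \<in> ?U \<longrightarrow> (\<exists>z'\<in>?V. z' \<in> K \<and> (z, z') \<notin> ?E)))"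
    using assms by (simp add: bit_fm_def sat_AllF sat_Imp sat_Or sat_side_fm)
  also have "\<dots> \<longleftrightarrow> has_clique ?E (so i) ?U"
    unfolding has_clique_def
  proof (intro iffI; elim exE conjE)
    fix K assume "K \<subseteq> ?V" "\<forall>z\<in>?V. z \<in> K \<longrightarrow> z \<in> so i \<and> z \<in> ?U"
      "\<forall>z\<in>?V. \<forall>z'\<in>?V. z \<in> K \<and> z' \<in> K \<longrightarrow> z = z' \<or> (z, z') \<in> ?E"
      "\<forall>z\<in>?V. z \<in> ?U \<longrightarrow> (\<exists>z'\<in>?V. z' \<in> K \<and> (z, z') \<notin> ?E)"
    then show "\<exists>K\<subseteq>?U \<inter> so i. (\<forall>z\<in>K. \<forall>z'\<in>K. z = z' \<or> (z, z') \<in> ?E) \<and>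
      (\<forall>z\<in>?U. \<exists>z'\<in>K. (z, z') \<notin> ?E)"
      using U by (intro exI[of _ K]) blast
  next
    fix K assume "K \<subseteq> ?U \<inter> so i" "\<forall>z\<in>K. \<forall>z'\<in>K. z = z' \<or> (z, z') \<in> ?E"
      "\<forall>z\<in>?U. \<exists>z'\<in>K. (z, z') \<notin> ?E"
    then show "\<exists>K\<subseteq>?V. (\<forall>z\<in>?V. z \<in> K \<longrightarrow> z \<in> so i \<and> z \<in> ?U) \<and>
      (\<forall>z\<in>?V. \<forall>z'\<in>?V. z \<in> K \<and> z' \<in> K \<longrightarrow> z = z' \<or> (z, z') \<in> ?E) \<and>
      (\<forall>z\<in>?V. z \<in> ?U \<longrightarrow> (\<exists>z'\<in>?V. z' \<in> K \<and> (z, z') \<notin> ?E))"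
      using U by (intro exI[of _ K]) blast
  qed
  finally show ?thesis .
qed

text \<open>It depends on the number of parameters only, so a single formula serves a whole class of
  bounded outdegree.\<close>

definition order_fm :: "nat \<Rightarrow> mso" where
  "order_fm n = Or (Eqv 0 1) (Disjs (\<lambda>i. Conj (bit_fm n 1 0 i) (Conj (Neg (bit_fm n 0 1 i))
     (Neg (Disjs (\<lambda>j. Neg (Iff (bit_fm n 0 1 j) (bit_fm n 1 0 j))) i)))) n)"

lemma sat_order_fm:
  assumes so: "\<And>i. i < n \<Longrightarrow> so i = {v \<in> verts G. i \<in> l v}"
  shows "sat G fo so (order_fm n) \<longleftrightarrow> fo 0 = fo 1 \<or>
    set_less n (bits (verts G) (edges G) l (fo 0) (fo 1)) (bits (verts G) (edges G) l (fo 1) (fo 0))"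
proof -
  have "has_clique E (so i) (side (verts G) E x y) \<longleftrightarrow> i \<in> bits (verts G) E l x y"
    if "i < n" for E x y i
  proof -
    have "side (verts G) E x y \<inter> so i = side (verts G) E x y \<inter> {v. i \<in> l v}"
      using so[OF that] by (auto simp: side_def)
    then show ?thesis by (simp add: bits_def has_clique_def)
  qed
  then have bit: "sat G fo so (bit_fm n p q i) \<longleftrightarrow> i \<in> bits (verts G) (edges G) l (fo p) (fo q)"
    if "i < n" "p < 2" "q < 2" for p q i
    using that sat_bit_fm by blast
  then show ?thesis
    unfolding order_fm_def set_less_def by (auto simp: sat_Or sat_Disjs sat_Iff)
qed

lemma bounded_imp_orderable:
  fixes C :: "'v graph set"
  assumes cog: "\<forall>G\<in>C. cograph G" and "bounded_cotree_outdeg C"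
  shows "mso_orderable C"
proof -
  from assms(2) obtain w where w: "\<And>G t. G \<in> C \<Longrightarrow> wf_cotree t \<Longrightarrow> cotree_graph t = G \<Longrightarrow> outdeg t \<le> w"
    unfolding bounded_cotree_outdeg_def by blast
  let ?n = "2 * w"
  have "\<exists>P. (\<forall>i<?n. P i \<subseteq> verts G) \<and> linear_order_on (verts G)
      {(a, b). a \<in> verts G \<and> b \<in> verts G \<and> sat_xyZ G (order_fm ?n) ?n a b P}"
    if G: "G \<in> C" for G
  proof -
    obtain t where t: "wf_cotree t" "cotree_graph t = G" using cog G cograph_cotree by blast
    have V: "verts G = leaves t" and E: "edges G = cotree_edges t"
      using t(2) by (auto simp: cotree_graph_def verts_def edges_def)
    \<comment> \<open>The root value \<open>{..<w}\<close> has size exactly \<open>w\<close> and so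
      meets the size condition for either label of the root.\<close>
    obtain l where l: "distinguished ?n l t"
      using labelling_exists[OF t(1) w[OF G t], of "{..<w}"] by auto
    define P where "P = (\<lambda>i. {v \<in> verts G. i \<in> l v})"
    \<comment> \<open>At the root there are no outside vertices, so the invariant holds
      trivially.\<close>
    have md: "is_module (verts G) (edges G) t" by (simp add: is_module_def V E)
    have "sat_xyZ G (order_fm ?n) ?n a b P \<longleftrightarrow> (a, b) \<in> tree_ord ?n l t"
      if "a \<in> verts G" "b \<in> verts G" for a b
    proof -
      have "sat_xyZ G (order_fm ?n) ?n a b P \<longleftrightarrow> a = b \<or>
          set_less ?n (bits (verts G) (edges G) l a b) (bits (verts G) (edges G) l b a)"
        unfolding sat_xyZ_def by (subst sat_order_fm[where l = l]) (auto simp: P_def)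
      also have "\<dots> \<longleftrightarrow> (a, b) \<in> tree_ord ?n l t"
        using tree_ord_eq_bits[OF _ t(1) md] that sym_cotree_edges[of t] unfolding V E by metis
      finally show ?thesis .
    qed
    then have "{(a, b). a \<in> verts G \<and> b \<in> verts G \<and> sat_xyZ G (order_fm ?n) ?n a b P} =
        tree_ord ?n l t"
      using tree_ord_subset[of ?n l t] V by auto
    then have "linear_order_on (verts G)
        {(a, b). a \<in> verts G \<and> b \<in> verts G \<and> sat_xyZ G (order_fm ?n) ?n a b P}"
      using linear_order_tree_ord[OF t(1) l] V by simp
    then show ?thesis by (intro exI[of _ P]) (auto simp: P_def)
  qed
  then show ?thesis unfolding mso_orderable_def by blast
qed

theorem theorem5p14:
  fixes C :: "'v graph set"
  assumes "\<forall>G\<in>C. cograph G"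
  shows "(mso_orderable C \<longleftrightarrow> has_CUT C) \<and> (has_CUT C \<longleftrightarrow> bounded_cotree_outdeg C)"
proof -
  have "finite (verts G) \<and> verts G \<noteq> {}" if "G \<in> C" for G
  proof -
    obtain t where "wf_cotree t" "cotree_graph t = G" using assms \<open>G \<in> C\<close> cograph_cotree by blast
    then show ?thesis
      using finite_leaves[of t] leaves_nonempty[of t] by (auto simp: cotree_graph_def verts_def)
  qed
  then show ?thesis
    using orderable_imp_CUT CUT_imp_bounded bounded_imp_orderable[OF assms] by blast
qed

end
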